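(* Let $k$ be an algebraically closed field of characteristic zero, let $n \geq 4$ be an integer, and let $A = (a_{ij})_{i,j=1,\dots,m}$ be an $m \times m$ matrix with entries in $k$, of rank $r$. (1) If $r + 2 \geq m$, then each of the Lie algebras $\mathfrak{g}(A)$ and $\tilde{\mathfrak{g}}(A)$ is a quotient of the Yang-Mills algebra $\mathfrak{ym}(n)$ (this includes in particular all affine Kac-Moody algebras). (2) If $r + 2 \leq m$, then each of the Lie algebras $\mathfrak{g}(A)$ and $\tilde{\mathfrak{g}}(A)$ is a quotient of the Yang-Mills algebra $\mathfrak{ym}(n)$ whenever $n \geq 2(m-r)$. Here "$\mathfrak{l}$ is a quotient of $\mathfrak{ym}(n)$" means that there exists a surjective morphism of Lie algebras $\mathfrak{ym}(n) \to \mathfrak{l}$.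
   Context: For an integer $n \geq 2$, let $\mathfrak{f}(x_1,\dots,x_n)$ be the free Lie algebra over $k$ on generators $x_1,\dots,x_n$. The Yang-Mills algebra on $n$ generators is the quotient Lie algebra $$\mathfrak{ym}(n) = \mathfrak{f}(x_1,\dots,x_n)\big/\big\langle \textstyle\sum_{i=1}^n [x_i,[x_i,x_j]] : 1 \leq j \leq n \big\rangle,$$ where $\langle\,\cdot\,\rangle$ denotes the Lie ideal generated by the given elements. Let $A=(a_{ij})_{i,j=1,\dots,m}$ be a matrix with entries in $k$ of rank $r$. A realization of $A$ is a triple $(\mathfrak{h},\Pi,\Pi^\vee)$, where $\mathfrak{h}$ is a $k$-vector space with $\dim \mathfrak{h} = 2m-r$, and $\Pi = \{\alpha_1,\dots,\alpha_m\} \subseteq \mathfrak{h}^*$ and $\Pi^\vee = \{\alpha_1^\vee,\dots,\alpha_m^\vee\} \subseteq \mathfrak{h}$ are linearly independent subsets such that $\langle \alpha_i^\vee,\alpha_j\rangle = a_{ij}$ for all $i,j=1,\dots,m$. A realization exists and is unique up to (not necessarily unique) isomorphism. Given a realization, $\tilde{\mathfrak{g}}(A)$ is the Lie algebra over $k$ generated by the vector space $\mathfrak{h} \oplus \mathrm{span}_k\{e_i,f_i : i=1,\dots,m\}$ modulo the relations $$[e_i,f_j]=\delta_{i,j}\,\alpha_i^\vee,\quad [h,h']=0,\quad [h,e_i]=\langle h,\alpha_i\rangle e_i,\quad [h,f_i]=-\langle h,\alpha_i\rangle f_i,$$ for all $i,j=1,\dots,m$ and $h,h'\in\mathfrak{h}$.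 The canonical map $\mathfrak{h}\to\tilde{\mathfrak{g}}(A)$ is injective, so $\mathfrak{h}$ is regarded as a subspace of $\tilde{\mathfrak{g}}(A)$. Among the ideals of $\tilde{\mathfrak{g}}(A)$ intersecting $\mathfrak{h}$ trivially there is a unique maximal one, denoted $\mathfrak{r}$, and $\mathfrak{g}(A) = \tilde{\mathfrak{g}}(A)/\mathfrak{r}$. If $A$ is a generalized Cartan matrix (integer entries, $a_{ii}=2$ for all $i$, $a_{ij}\leq 0$ for $i\neq j$, and $a_{ij}=0$ implies $a_{ji}=0$), then $\mathfrak{g}(A)$ is called the Kac-Moody algebra associated to $A$; it is affine if $A$ is a generalized Cartan matrix of affine type (in which case $r = m-1$). *)

theory Defs
  imports "HOL-Analysis.Analysis"
begin

section \<open>Lie algebras over a field\<close>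

text \<open>Lie algebras are records with an explicit carrier, since the ideals by which we take
  quotients depend on parameters.\<close>

record ('k, 'a) lie_struct =
  lie_carrier :: "'a set"
  lie_add :: "'a \<Rightarrow> 'a \<Rightarrow> 'a"
  lie_zero :: 'a
  lie_scale :: "'k \<Rightarrow> 'a \<Rightarrow> 'a"
  lie_bracket :: "'a \<Rightarrow> 'a \<Rightarrow> 'a"

definition lie_minus :: "('k::field, 'a) lie_struct \<Rightarrow> 'a \<Rightarrow> 'a \<Rightarrow> 'a" where
  "lie_minus L a b = lie_add L a (lie_scale L (- 1) b)"

definition lie_sum :: "('k, 'a) lie_struct \<Rightarrow> ('i \<Rightarrow> 'a) \<Rightarrow> 'i list \<Rightarrow> 'a" where
  "lie_sum L f is = foldr (\<lambda>i. lie_add L (f i)) is (lie_zero L)"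

locale lie_algebra =
  fixes L :: "('k::field, 'a) lie_struct"
  assumes zero_closed: "lie_zero L \<in> lie_carrier L"
    and add_closed: "\<lbrakk>a \<in> lie_carrier L; b \<in> lie_carrier L\<rbrakk> \<Longrightarrow> lie_add L a b \<in> lie_carrier L"
    and scale_closed: "a \<in> lie_carrier L \<Longrightarrow> lie_scale L r a \<in> lie_carrier L"
    and bracket_closed:
      "\<lbrakk>a \<in> lie_carrier L; b \<in> lie_carrier L\<rbrakk> \<Longrightarrow> lie_bracket L a b \<in> lie_carrier L"
    and add_assoc: "\<lbrakk>a \<in> lie_carrier L; b \<in> lie_carrier L; d \<in> lie_carrier L\<rbrakk>
      \<Longrightarrow> lie_add L (lie_add L a b) d = lie_add L a (lie_add L b d)"
    and add_commute: "\<lbrakk>a \<in> lie_carrier L; b \<in> lie_carrier L\<rbrakk> \<Longrightarrow> lie_add L a b = lie_add L b a"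
    and add_zero: "a \<in> lie_carrier L \<Longrightarrow> lie_add L a (lie_zero L) = a"
    and add_neg: "a \<in> lie_carrier L \<Longrightarrow> lie_add L a (lie_scale L (- 1) a) = lie_zero L"
    and scale_add: "\<lbrakk>a \<in> lie_carrier L; b \<in> lie_carrier L\<rbrakk>
      \<Longrightarrow> lie_scale L r (lie_add L a b) = lie_add L (lie_scale L r a) (lie_scale L r b)"
    and add_scale: "a \<in> lie_carrier L
      \<Longrightarrow> lie_scale L (r + s) a = lie_add L (lie_scale L r a) (lie_scale L s a)"
    and scale_scale: "a \<in> lie_carrier L \<Longrightarrow> lie_scale L r (lie_scale L s a) = lie_scale L (r * s) a"
    and scale_one: "a \<in> lie_carrier L \<Longrightarrow> lie_scale L 1 a = a"
    and bracket_add_left: "\<lbrakk>a \<in> lie_carrier L; b \<in> lie_carrier L; d \<in> lie_carrier L\<rbrakk>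
      \<Longrightarrow> lie_bracket L (lie_add L a b) d = lie_add L (lie_bracket L a d) (lie_bracket L b d)"
    and bracket_add_right: "\<lbrakk>a \<in> lie_carrier L; b \<in> lie_carrier L; d \<in> lie_carrier L\<rbrakk>
      \<Longrightarrow> lie_bracket L a (lie_add L b d) = lie_add L (lie_bracket L a b) (lie_bracket L a d)"
    and bracket_scale_left: "\<lbrakk>a \<in> lie_carrier L; b \<in> lie_carrier L\<rbrakk>
      \<Longrightarrow> lie_bracket L (lie_scale L r a) b = lie_scale L r (lie_bracket L a b)"
    and bracket_scale_right: "\<lbrakk>a \<in> lie_carrier L; b \<in> lie_carrier L\<rbrakk>
      \<Longrightarrow> lie_bracket L a (lie_scale L r b) = lie_scale L r (lie_bracket L a b)"
    and bracket_self: "a \<in> lie_carrier L \<Longrightarrow> lie_bracket L a a = lie_zero L"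
    and jacobi: "\<lbrakk>a \<in> lie_carrier L; b \<in> lie_carrier L; d \<in> lie_carrier L\<rbrakk>
      \<Longrightarrow> lie_add L (lie_bracket L a (lie_bracket L b d))
           (lie_add L (lie_bracket L b (lie_bracket L d a)) (lie_bracket L d (lie_bracket L a b)))
         = lie_zero L"

definition lie_hom :: "('k, 'a) lie_struct \<Rightarrow> ('k, 'b) lie_struct \<Rightarrow> ('a \<Rightarrow> 'b) \<Rightarrow> bool" where
  "lie_hom L M \<phi> \<longleftrightarrow>
     (\<forall>a\<in>lie_carrier L. \<phi> a \<in> lie_carrier M) \<and>
     (\<forall>a\<in>lie_carrier L. \<forall>b\<in>lie_carrier L. \<phi> (lie_add L a b) = lie_add M (\<phi> a) (\<phi> b)) \<and>
     (\<forall>c. \<forall>a\<in>lie_carrier L. \<phi> (lie_scale L c a) = lie_scale M c (\<phi> a)) \<and>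
     (\<forall>a\<in>lie_carrier L. \<forall>b\<in>lie_carrier L.
        \<phi> (lie_bracket L a b) = lie_bracket M (\<phi> a) (\<phi> b))"

definition is_lie_quotient_of :: "('k, 'b) lie_struct \<Rightarrow> ('k, 'a) lie_struct \<Rightarrow> bool" where
  "is_lie_quotient_of M L \<longleftrightarrow> (\<exists>\<phi>. lie_hom L M \<phi> \<and> \<phi> ` lie_carrier L = lie_carrier M)"

definition lie_ideal :: "('k, 'a) lie_struct \<Rightarrow> 'a set \<Rightarrow> bool" where
  "lie_ideal L I \<longleftrightarrow>
     I \<subseteq> lie_carrier L \<and> lie_zero L \<in> I \<and>
     (\<forall>a\<in>I. \<forall>b\<in>I. lie_add L a b \<in> I) \<and>
     (\<forall>c. \<forall>a\<in>I. lie_scale L c a \<in> I) \<and>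
     (\<forall>x\<in>lie_carrier L. \<forall>a\<in>I. lie_bracket L x a \<in> I)"

definition lie_ideal_generated :: "('k, 'a) lie_struct \<Rightarrow> 'a set \<Rightarrow> 'a set" where
  "lie_ideal_generated L S = \<Inter>{I. lie_ideal L I \<and> S \<subseteq> I}"

definition lie_coset :: "('k, 'a) lie_struct \<Rightarrow> 'a set \<Rightarrow> 'a \<Rightarrow> 'a set" where
  "lie_coset L I a = lie_add L a ` I"

definition lie_quotient :: "('k, 'a) lie_struct \<Rightarrow> 'a set \<Rightarrow> ('k, 'a set) lie_struct" where
  "lie_quotient L I =
    \<lparr>lie_carrier = lie_coset L I ` lie_carrier L,
     lie_add = (\<lambda>P Q. \<Union>p\<in>P. \<Union>q\<in>Q. lie_coset L I (lie_add L p q)),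
     lie_zero = lie_coset L I (lie_zero L),
     lie_scale = (\<lambda>c P. \<Union>p\<in>P. lie_coset L I (lie_scale L c p)),
     lie_bracket = (\<lambda>P Q. \<Union>p\<in>P. \<Union>q\<in>Q. lie_coset L I (lie_bracket L p q))\<rparr>"

context lie_algebra
begin

lemma add_left_commute: "\<lbrakk>a \<in> lie_carrier L; b \<in> lie_carrier L; d \<in> lie_carrier L\<rbrakk>
      \<Longrightarrow> lie_add L a (lie_add L b d) = lie_add L b (lie_add L a d)"
  by (metis add_assoc add_commute)

lemma lie_coset_eq:
  assumes I: "lie_ideal L I" and "a \<in> lie_carrier L" "p \<in> lie_coset L I a"
  shows "lie_coset L I p = lie_coset L I a"
proof -
  from assms obtain i where i: "i \<in> I" "p = lie_add L a i" by (auto simp: lie_coset_def)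
  have sub: "I \<subseteq> lie_carrier L" using I by (simp add: lie_ideal_def)
  have "lie_add L p x \<in> lie_coset L I a" if "x \<in> I" for x
    using i sub that I by (simp add: assms(2) subsetD add_assoc lie_coset_def lie_ideal_def)
  moreover have "lie_add L a x \<in> lie_coset L I p" if "x \<in> I" for x
  proof -
    let ?y = "lie_add L (lie_scale L (-1) i) x"
    have y: "?y \<in> I" using i that I by (simp add: lie_ideal_def)
    have "lie_add L p ?y = lie_add L a (lie_add L (lie_add L i (lie_scale L (-1) i)) x)"
      using i sub that assms(2) by (simp add: subsetD add_assoc add_closed scale_closed)
    also have "\<dots> = lie_add L a x" using i sub that assms(2) by (metis subsetD add_neg add_commute add_zero zero_closed)
    finally show ?thesis using y unfolding lie_coset_def by (metis imageI)
  qed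
  ultimately show ?thesis by (auto simp: lie_coset_def)
qed

lemma lie_coset_self: "lie_ideal L I \<Longrightarrow> a \<in> lie_carrier L \<Longrightarrow> a \<in> lie_coset L I a"
  unfolding lie_coset_def by (metis add_zero imageI lie_ideal_def)

lemma lie_ideal_bracket_left: assumes "lie_ideal L I" "i \<in> I" "x \<in> lie_carrier L" shows "lie_bracket L i x \<in> I"
proof -
  have i: "i \<in> lie_carrier L" using assms by (auto simp: lie_ideal_def)
  let ?a = "lie_bracket L i x" and ?b = "lie_bracket L x i"
  have ab: "?a \<in> lie_carrier L" "?b \<in> lie_carrier L" using i assms by (auto intro: bracket_closed)
  have ix: "lie_add L i x \<in> lie_carrier L" using i assms(3) by (rule add_closed)
  have "lie_bracket L i (lie_add L i x) = ?a"
    using add_commute[OF zero_closed ab(1)]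
    by (simp add: bracket_add_right[OF i i assms(3)] bracket_self[OF i] add_zero[OF ab(1)])
  moreover have "lie_bracket L x (lie_add L i x) = ?b"
    by (simp add: bracket_add_right[OF assms(3) i assms(3)] bracket_self[OF assms(3)] add_zero[OF ab(2)])
  ultimately have sum: "lie_add L ?a ?b = lie_zero L"
    using bracket_add_left[OF i assms(3) ix] bracket_self[OF ix] by simp
  let ?nb = "lie_scale L (- 1) ?b"
  have nb: "?nb \<in> lie_carrier L" using ab(2) by (rule scale_closed)
  have "?a = lie_add L ?a (lie_add L ?b ?nb)" by (simp add: add_neg[OF ab(2)] add_zero[OF ab(1)])
  also have "\<dots> = lie_add L (lie_zero L) ?nb" by (simp add: add_assoc[OF ab nb, symmetric] sum)
  also have "\<dots> = ?nb" by (simp add: add_commute[OF zero_closed nb] add_zero[OF nb])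
  finally have "?a = ?nb" .
  then show ?thesis using assms by (auto simp: lie_ideal_def)
qed

lemma lie_coset_simps:
  assumes I: "lie_ideal L I" and ab: "a \<in> lie_carrier L" "b \<in> lie_carrier L"
  shows "(\<Union>p\<in>lie_coset L I a. \<Union>q\<in>lie_coset L I b. lie_coset L I (lie_add L p q)) = lie_coset L I (lie_add L a b)"
   and "(\<Union>p\<in>lie_coset L I a. \<Union>q\<in>lie_coset L I b. lie_coset L I (lie_bracket L p q)) = lie_coset L I (lie_bracket L a b)"
   and "(\<Union>p\<in>lie_coset L I a. lie_coset L I (lie_scale L c p)) = lie_coset L I (lie_scale L c a)"
proof -
  note self = lie_coset_self[OF I ab(1)] lie_coset_self[OF I ab(2)]
  have sub: "I \<subseteq> lie_carrier L" using I by (simp add: lie_ideal_def)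
  have 1: "lie_coset L I (lie_add L p q) = lie_coset L I (lie_add L a b)"
      "lie_coset L I (lie_bracket L p q) = lie_coset L I (lie_bracket L a b)"
      "lie_coset L I (lie_scale L c p) = lie_coset L I (lie_scale L c a)"
    if pq: "p \<in> lie_coset L I a" "q \<in> lie_coset L I b" for p q
  proof -
    from pq obtain i j where i: "i \<in> I" "p = lie_add L a i" and j: "j \<in> I" "q = lie_add L b j" by (auto simp: lie_coset_def)
    have ij: "i \<in> lie_carrier L" "j \<in> lie_carrier L" using i j sub by auto
    have "lie_add L p q = lie_add L (lie_add L a b) (lie_add L i j)"
      using i(2) j(2) ij ab by (simp add: add_assoc add_closed add_left_commute)
    then have "lie_add L p q \<in> lie_coset L I (lie_add L a b)" using I i j by (auto simp: lie_coset_def lie_ideal_def)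
    then show "lie_coset L I (lie_add L p q) = lie_coset L I (lie_add L a b)"
      by (intro lie_coset_eq) (use I ab in \<open>auto intro: add_closed\<close>)
    have "lie_bracket L p q = lie_add L (lie_bracket L a b) (lie_add L (lie_bracket L i b) (lie_add L (lie_bracket L a j) (lie_bracket L i j)))"
      using i(2) j(2) ij ab by (simp add: add_assoc add_closed add_left_commute bracket_add_left bracket_add_right bracket_closed)
    moreover have "lie_add L (lie_bracket L i b) (lie_add L (lie_bracket L a j) (lie_bracket L i j)) \<in> I"
      using I i j ij ab lie_ideal_bracket_left[OF I] by (simp add: lie_ideal_def)
    ultimately have "lie_bracket L p q \<in> lie_coset L I (lie_bracket L a b)" by (auto simp: lie_coset_def lie_ideal_def)
    then show "lie_coset L I (lie_bracket L p q) = lie_coset L I (lie_bracket L a b)"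
      by (intro lie_coset_eq) (use I ab in \<open>auto intro: bracket_closed\<close>)
    have "lie_scale L c p \<in> lie_coset L I (lie_scale L c a)" using I i ij ab by (auto simp: lie_coset_def lie_ideal_def scale_add)
    then show "lie_coset L I (lie_scale L c p) = lie_coset L I (lie_scale L c a)"
      by (intro lie_coset_eq) (use I ab in \<open>auto intro: scale_closed\<close>)
  qed
  show "(\<Union>p\<in>lie_coset L I a. \<Union>q\<in>lie_coset L I b. lie_coset L I (lie_add L p q)) = lie_coset L I (lie_add L a b)"
   "(\<Union>p\<in>lie_coset L I a. \<Union>q\<in>lie_coset L I b. lie_coset L I (lie_bracket L p q)) = lie_coset L I (lie_bracket L a b)"
   "(\<Union>p\<in>lie_coset L I a. lie_coset L I (lie_scale L c p)) = lie_coset L I (lie_scale L c a)"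
    using 1 self by blast+
qed

lemma lie_algebra_lie_quotient: assumes I: "lie_ideal L I" shows "lie_algebra (lie_quotient L I)"
proof -
  let ?Q = "lie_quotient L I"
  have c: "lie_carrier ?Q = lie_coset L I ` lie_carrier L" "lie_zero ?Q = lie_coset L I (lie_zero L)" by (simp_all add: lie_quotient_def)
  have a: "lie_add ?Q (lie_coset L I a) (lie_coset L I b) = lie_coset L I (lie_add L a b)"
    "lie_bracket ?Q (lie_coset L I a) (lie_coset L I b) = lie_coset L I (lie_bracket L a b)"
    if "a \<in> lie_carrier L" "b \<in> lie_carrier L" for a b
    using lie_coset_simps[OF I that] by (simp_all add: lie_quotient_def)
  have sc: "lie_scale ?Q r (lie_coset L I a) = lie_coset L I (lie_scale L r a)"
    if "a \<in> lie_carrier L" for a r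
    using lie_coset_simps(3)[OF I that that] by (simp add: lie_quotient_def)
  have comm: "lie_add ?Q P R = lie_add ?Q R P"
    if P: "P \<in> lie_carrier ?Q" and R: "R \<in> lie_carrier ?Q" for P R
  proof -
    from P R obtain x y where xy: "x \<in> lie_carrier L" "y \<in> lie_carrier L"
        and PR: "P = lie_coset L I x" "R = lie_coset L I y"
      unfolding c by blast
    show ?thesis unfolding PR a(1)[OF xy] a(1)[OF xy(2,1)] add_commute[OF xy] ..
  qed
  note [simp] = zero_closed add_closed scale_closed bracket_closed add_assoc add_zero add_neg
    scale_add add_scale scale_scale scale_one bracket_add_left bracket_add_right
    bracket_scale_left bracket_scale_right bracket_self jacobi
  show ?thesis
    by unfold_locales ((rule comm; assumption) | (clarsimp simp: c a sc))+
qed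

lemma lie_ideal_lie_ideal_generated: "S \<subseteq> lie_carrier L \<Longrightarrow> lie_ideal L (lie_ideal_generated L S)"
proof -
  assume S: "S \<subseteq> lie_carrier L"
  have "lie_ideal L (lie_carrier L)" by (simp add: lie_ideal_def zero_closed add_closed scale_closed bracket_closed)
  with S show ?thesis unfolding lie_ideal_generated_def by (auto simp: lie_ideal_def)
qed

end


section \<open>Free Lie algebras\<close>

text \<open>The free Lie algebra on a set \<open>X\<close> consists of the formal Lie expressions in elements of
  \<open>X\<close>, modulo the smallest congruence that enforces the axioms of a Lie algebra.\<close>

datatype ('k, lie_gens: 'x) lie_term =
  Gen 'x
| Zero
| Plus "('k, 'x) lie_term" "('k, 'x) lie_term"
| Scale 'k "('k, 'x) lie_term"
| Bracket "('k, 'x) lie_term" "('k, 'x) lie_term"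

definition lie_terms :: "'x set \<Rightarrow> ('k, 'x) lie_term set" where
  "lie_terms X = {t. lie_gens t \<subseteq> X}"

inductive lie_eq :: "'x set \<Rightarrow> ('k::field, 'x) lie_term \<Rightarrow> ('k, 'x) lie_term \<Rightarrow> bool"
  for X :: "'x set" where
  refl: "s \<in> lie_terms X \<Longrightarrow> lie_eq X s s"
| sym: "lie_eq X s t \<Longrightarrow> lie_eq X t s"
| trans: "lie_eq X s t \<Longrightarrow> lie_eq X t u \<Longrightarrow> lie_eq X s u"
| cong_Plus: "lie_eq X s s' \<Longrightarrow> lie_eq X t t' \<Longrightarrow> lie_eq X (Plus s t) (Plus s' t')"
| cong_Scale: "lie_eq X s s' \<Longrightarrow> lie_eq X (Scale c s) (Scale c s')"
| cong_Bracket: "lie_eq X s s' \<Longrightarrow> lie_eq X t t' \<Longrightarrow> lie_eq X (Bracket s t) (Bracket s' t')"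
| add_assoc: "\<lbrakk>s \<in> lie_terms X; t \<in> lie_terms X; u \<in> lie_terms X\<rbrakk>
    \<Longrightarrow> lie_eq X (Plus (Plus s t) u) (Plus s (Plus t u))"
| add_commute: "\<lbrakk>s \<in> lie_terms X; t \<in> lie_terms X\<rbrakk> \<Longrightarrow> lie_eq X (Plus s t) (Plus t s)"
| add_zero: "s \<in> lie_terms X \<Longrightarrow> lie_eq X (Plus s Zero) s"
| add_neg: "s \<in> lie_terms X \<Longrightarrow> lie_eq X (Plus s (Scale (- 1) s)) Zero"
| scale_add: "\<lbrakk>s \<in> lie_terms X; t \<in> lie_terms X\<rbrakk>
    \<Longrightarrow> lie_eq X (Scale c (Plus s t)) (Plus (Scale c s) (Scale c t))"
| add_scale: "s \<in> lie_terms X \<Longrightarrow> lie_eq X (Scale (c + d) s) (Plus (Scale c s) (Scale d s))"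
| scale_scale: "s \<in> lie_terms X \<Longrightarrow> lie_eq X (Scale c (Scale d s)) (Scale (c * d) s)"
| scale_one: "s \<in> lie_terms X \<Longrightarrow> lie_eq X (Scale 1 s) s"
| bracket_add_left: "\<lbrakk>s \<in> lie_terms X; t \<in> lie_terms X; u \<in> lie_terms X\<rbrakk>
    \<Longrightarrow> lie_eq X (Bracket (Plus s t) u) (Plus (Bracket s u) (Bracket t u))"
| bracket_add_right: "\<lbrakk>s \<in> lie_terms X; t \<in> lie_terms X; u \<in> lie_terms X\<rbrakk>
    \<Longrightarrow> lie_eq X (Bracket s (Plus t u)) (Plus (Bracket s t) (Bracket s u))"
| bracket_scale_left: "\<lbrakk>s \<in> lie_terms X; t \<in> lie_terms X\<rbrakk>
    \<Longrightarrow> lie_eq X (Bracket (Scale c s) t) (Scale c (Bracket s t))"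
| bracket_scale_right: "\<lbrakk>s \<in> lie_terms X; t \<in> lie_terms X\<rbrakk>
    \<Longrightarrow> lie_eq X (Bracket s (Scale c t)) (Scale c (Bracket s t))"
| bracket_self: "s \<in> lie_terms X \<Longrightarrow> lie_eq X (Bracket s s) Zero"
| jacobi: "\<lbrakk>s \<in> lie_terms X; t \<in> lie_terms X; u \<in> lie_terms X\<rbrakk>
    \<Longrightarrow> lie_eq X
      (Plus (Bracket s (Bracket t u)) (Plus (Bracket t (Bracket u s)) (Bracket u (Bracket s t))))
      Zero"

definition lie_class :: "'x set \<Rightarrow> ('k::field, 'x) lie_term \<Rightarrow> ('k, 'x) lie_term set" where
  "lie_class X t = {s. lie_eq X t s}"

definition free_lie :: "'x set \<Rightarrow> ('k::field, ('k, 'x) lie_term set) lie_struct" where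
  "free_lie X =
    \<lparr>lie_carrier = lie_class X ` lie_terms X,
     lie_add = (\<lambda>P Q. \<Union>s\<in>P. \<Union>t\<in>Q. lie_class X (Plus s t)),
     lie_zero = lie_class X Zero,
     lie_scale = (\<lambda>c P. \<Union>s\<in>P. lie_class X (Scale c s)),
     lie_bracket = (\<lambda>P Q. \<Union>s\<in>P. \<Union>t\<in>Q. lie_class X (Bracket s t))\<rparr>"

definition free_lie_gen :: "'x set \<Rightarrow> 'x \<Rightarrow> ('k::field, 'x) lie_term set" where
  "free_lie_gen X x = lie_class X (Gen x)"

lemma lie_eq_terms: "lie_eq X s t \<Longrightarrow> s \<in> lie_terms X \<and> t \<in> lie_terms X"
  by (induction rule: lie_eq.induct) (auto simp: lie_terms_def)

lemma lie_class_eqI: "lie_eq X s t \<Longrightarrow> lie_class X s = lie_class X t"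
  unfolding lie_class_def by (auto intro: lie_eq.trans lie_eq.sym)

lemma lie_class_simps:
  assumes "s \<in> lie_terms X" "t \<in> lie_terms X"
  shows "(\<Union>p\<in>lie_class X s. \<Union>q\<in>lie_class X t. lie_class X (Plus p q)) = lie_class X (Plus s t)"
   and "(\<Union>p\<in>lie_class X s. \<Union>q\<in>lie_class X t. lie_class X (Bracket p q)) = lie_class X (Bracket s t)"
   and "(\<Union>p\<in>lie_class X s. lie_class X (Scale c p)) = lie_class X (Scale c s)"
proof -
  have self: "s \<in> lie_class X s" "t \<in> lie_class X t"
    using assms by (auto simp: lie_class_def intro: lie_eq.refl)
  have "lie_class X (Plus p q) = lie_class X (Plus s t)" if "p \<in> lie_class X s" "q \<in> lie_class X t" for p q
    using that by (intro lie_class_eqI) (auto simp: lie_class_def intro: lie_eq.intros)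
  then show "(\<Union>p\<in>lie_class X s. \<Union>q\<in>lie_class X t. lie_class X (Plus p q)) = lie_class X (Plus s t)"
    using self by (smt (verit) SUP_eq_const UN_constant empty_iff image_cong)
  have "lie_class X (Bracket p q) = lie_class X (Bracket s t)" if "p \<in> lie_class X s" "q \<in> lie_class X t" for p q
    using that by (intro lie_class_eqI) (auto simp: lie_class_def intro: lie_eq.intros)
  then show "(\<Union>p\<in>lie_class X s. \<Union>q\<in>lie_class X t. lie_class X (Bracket p q)) = lie_class X (Bracket s t)"
    using self by (smt (verit) SUP_eq_const UN_constant empty_iff image_cong)
  have "lie_class X (Scale c p) = lie_class X (Scale c s)" if "p \<in> lie_class X s" for p
    using that by (intro lie_class_eqI) (auto simp: lie_class_def intro: lie_eq.intros)
  then show "(\<Union>p\<in>lie_class X s. lie_class X (Scale c p)) = lie_class X (Scale c s)"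
    using self by (smt (verit) SUP_eq_const UN_constant empty_iff image_cong)
qed

lemma lie_terms_simps: "Zero \<in> lie_terms X" "Plus s t \<in> lie_terms X \<longleftrightarrow> s \<in> lie_terms X \<and> t \<in> lie_terms X"
  "Bracket s t \<in> lie_terms X \<longleftrightarrow> s \<in> lie_terms X \<and> t \<in> lie_terms X"
  "Scale c s \<in> lie_terms X \<longleftrightarrow> s \<in> lie_terms X"
  "Gen x \<in> lie_terms X \<longleftrightarrow> x \<in> X"
  by (auto simp: lie_terms_def)

lemma lie_algebra_free_lie: "lie_algebra (free_lie X)"
proof -
  let ?Q = "free_lie X"
  have c: "lie_carrier ?Q = lie_class X ` lie_terms X" "lie_zero ?Q = lie_class X Zero" by (simp_all add: free_lie_def)
  have a: "lie_add ?Q (lie_class X a) (lie_class X b) = lie_class X (Plus a b)"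
    "lie_bracket ?Q (lie_class X a) (lie_class X b) = lie_class X (Bracket a b)"
    if "a \<in> lie_terms X" "b \<in> lie_terms X" for a b
    using lie_class_simps[OF that] by (simp_all add: free_lie_def)
  have sc: "lie_scale ?Q r (lie_class X a) = lie_class X (Scale r a)"
    if "a \<in> lie_terms X" for a r
    using lie_class_simps(3)[OF that that] by (simp add: free_lie_def)
  show ?thesis
    by unfold_locales (clarsimp simp: c a sc lie_terms_simps; (intro imageI lie_class_eqI lie_eq.intros(7-))?; simp add: lie_terms_simps)+
qed

text \<open>Evaluation of Lie expressions, giving the universal property of the free Lie algebra.\<close>

primrec lie_eval :: "('k, 'a) lie_struct \<Rightarrow> ('x \<Rightarrow> 'a) \<Rightarrow> ('k, 'x) lie_term \<Rightarrow> 'a" where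
  "lie_eval L g (Gen x) = g x"
| "lie_eval L g Zero = lie_zero L"
| "lie_eval L g (Plus s t) = lie_add L (lie_eval L g s) (lie_eval L g t)"
| "lie_eval L g (Scale c s) = lie_scale L c (lie_eval L g s)"
| "lie_eval L g (Bracket s t) = lie_bracket L (lie_eval L g s) (lie_eval L g t)"

lemma lie_eval_closed: assumes "lie_algebra L" "g ` X \<subseteq> lie_carrier L" "t \<in> lie_terms X"
  shows "lie_eval L g t \<in> lie_carrier L"
  using assms(3)
proof (induction t)
qed (use assms in \<open>auto simp: lie_terms_simps intro: lie_algebra.zero_closed lie_algebra.add_closed lie_algebra.scale_closed lie_algebra.bracket_closed\<close>)

lemma lie_eval_cong: assumes L: "lie_algebra L" and g: "g ` X \<subseteq> lie_carrier L" and "lie_eq X s t"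
  shows "lie_eval L g s = lie_eval L g t"
proof -
  interpret lie_algebra L by fact
  note c = lie_eval_closed[OF L g]
  show ?thesis using assms(3)
    by (induction rule: lie_eq.induct)
      (simp_all add: c add_assoc add_zero add_neg scale_add add_scale scale_scale scale_one bracket_add_left bracket_add_right
        bracket_scale_left bracket_scale_right bracket_self jacobi add_commute)
qed

text \<open>The Lie algebra generated by a vector space: here the generators are the elements of a
  vector space \<open>'v\<close>, whose linear structure is imposed on the free Lie algebra on the set \<open>'v\<close>.\<close>

definition linear_relators ::
  "('k::field \<Rightarrow> 'v::ab_group_add \<Rightarrow> 'v) \<Rightarrow> ('k, 'v) lie_term set set" where
  "linear_relators sc =
    (let F = free_lie UNIV; \<iota> = free_lie_gen UNIV in
      {lie_minus F (\<iota> (u + v)) (lie_add F (\<iota> u) (\<iota> v)) | u v. True} \<union>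
      {lie_minus F (\<iota> (sc c v)) (lie_scale F c (\<iota> v)) | c v. True})"

definition linear_relations_ideal ::
  "('k::field \<Rightarrow> 'v::ab_group_add \<Rightarrow> 'v) \<Rightarrow> ('k, 'v) lie_term set set" where
  "linear_relations_ideal sc = lie_ideal_generated (free_lie UNIV) (linear_relators sc)"

definition free_lie_space :: "('k::field \<Rightarrow> 'v::ab_group_add \<Rightarrow> 'v)
    \<Rightarrow> ('k, ('k, 'v) lie_term set set) lie_struct" where
  "free_lie_space sc = lie_quotient (free_lie UNIV) (linear_relations_ideal sc)"

definition free_lie_space_incl :: "('k::field \<Rightarrow> 'v::ab_group_add \<Rightarrow> 'v)
    \<Rightarrow> 'v \<Rightarrow> ('k, 'v) lie_term set set" where
  "free_lie_space_incl sc v =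
    lie_coset (free_lie UNIV) (linear_relations_ideal sc) (free_lie_gen UNIV v)"


section \<open>Yang-Mills algebras\<close>

definition yang_mills_relator :: "nat \<Rightarrow> nat \<Rightarrow> ('k::field, nat) lie_term set" where
  "yang_mills_relator n j =
    (let F = free_lie {1..n}; x = free_lie_gen {1..n} in
      lie_sum F (\<lambda>i. lie_bracket F (x i) (lie_bracket F (x i) (x j))) [1..<Suc n])"

definition yang_mills :: "nat \<Rightarrow> ('k::field, ('k, nat) lie_term set set) lie_struct" where
  "yang_mills n = lie_quotient (free_lie {1..n})
     (lie_ideal_generated (free_lie {1..n}) (yang_mills_relator n ` {1..n}))"


section \<open>Realizations and Kac-Moody algebras\<close>

text \<open>The finite type \<open>'m\<close> indexes the rows and columns of \<open>A\<close>, and the vector space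
  \<open>\<hh>\<close> is the whole type \<open>'h\<close> with scalar multiplication \<open>sc\<close>.  As
  \<open>2 * CARD('m) - rank A > 0\<close>, the condition on \<open>dim\<close> also forces \<open>\<hh>\<close> to be
  finite-dimensional.\<close>

locale realization = vector_space sc
  for sc :: "'k::field \<Rightarrow> 'h::ab_group_add \<Rightarrow> 'h" +
  fixes A :: "'k^'m^'m"
    and \<alpha> :: "'m \<Rightarrow> 'h \<Rightarrow> 'k"
    and \<alpha>v :: "'m \<Rightarrow> 'h"
  assumes dim_eq: "dim UNIV = 2 * CARD('m) - rank A"
    and root_linear: "\<And>i. Vector_Spaces.linear sc (*) (\<alpha> i)"
    and roots_independent:
      "\<And>c. (\<And>h. (\<Sum>i\<in>UNIV. c i * \<alpha> i h) = 0) \<Longrightarrow> (\<And>i. c i = 0)"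
    and coroots_distinct: "inj \<alpha>v"
    and coroots_independent: "independent (range \<alpha>v)"
    and pairing: "\<And>i j. \<alpha> j (\<alpha>v i) = A $ i $ j"

text \<open>The generating space \<open>\<hh> \<oplus> span {e\<^sub>i, f\<^sub>i}\<close> is modelled as
  \<open>'h \<times> ('k^'m) \<times> ('k^'m)\<close>, the last two factors having bases \<open>e\<^sub>i\<close> and \<open>f\<^sub>i\<close>.\<close>

definition km_scale :: "('k::field \<Rightarrow> 'h::ab_group_add \<Rightarrow> 'h)
    \<Rightarrow> 'k \<Rightarrow> 'h \<times> ('k^'m) \<times> ('k^'m) \<Rightarrow> 'h \<times> ('k^'m) \<times> ('k^'m)" where
  "km_scale sc c = (\<lambda>(h, u, w). (sc c h, c *s u, c *s w))"

type_synonym ('k, 'h, 'm) km_free = "('k, 'h \<times> ('k^'m) \<times> ('k^'m)) lie_term set set"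

definition km_relators :: "('k::field \<Rightarrow> 'h::ab_group_add \<Rightarrow> 'h) \<Rightarrow> ('m::finite \<Rightarrow> 'h \<Rightarrow> 'k)
    \<Rightarrow> ('m \<Rightarrow> 'h) \<Rightarrow> ('k, 'h, 'm) km_free set" where
  "km_relators sc \<alpha> \<alpha>v =
    (let F = free_lie_space (km_scale sc);
         \<iota> = free_lie_space_incl (km_scale sc);
         H = (\<lambda>h. \<iota> (h, 0, 0));
         e = (\<lambda>i. \<iota> (0, axis i 1, 0));
         f = (\<lambda>i. \<iota> (0, 0, axis i 1))
     in {lie_minus F (lie_bracket F (e i) (f j)) (if i = j then H (\<alpha>v i) else lie_zero F)
           | i j. True} \<union>
        {lie_bracket F (H h) (H h') | h h'. True} \<union>
        {lie_minus F (lie_bracket F (H h) (e i)) (lie_scale F (\<alpha> i h) (e i)) | h i. True} \<union>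
        {lie_minus F (lie_bracket F (H h) (f i)) (lie_scale F (- \<alpha> i h) (f i)) | h i. True})"

definition km_relations_ideal :: "('k::field \<Rightarrow> 'h::ab_group_add \<Rightarrow> 'h)
    \<Rightarrow> ('m::finite \<Rightarrow> 'h \<Rightarrow> 'k) \<Rightarrow> ('m \<Rightarrow> 'h) \<Rightarrow> ('k, 'h, 'm) km_free set" where
  "km_relations_ideal sc \<alpha> \<alpha>v =
    lie_ideal_generated (free_lie_space (km_scale sc)) (km_relators sc \<alpha> \<alpha>v)"

definition km_tilde :: "('k::field \<Rightarrow> 'h::ab_group_add \<Rightarrow> 'h) \<Rightarrow> ('m::finite \<Rightarrow> 'h \<Rightarrow> 'k)
    \<Rightarrow> ('m \<Rightarrow> 'h) \<Rightarrow> ('k, ('k, 'h, 'm) km_free set) lie_struct" where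
  "km_tilde sc \<alpha> \<alpha>v =
    lie_quotient (free_lie_space (km_scale sc)) (km_relations_ideal sc \<alpha> \<alpha>v)"

definition km_cartan :: "('k::field \<Rightarrow> 'h::ab_group_add \<Rightarrow> 'h) \<Rightarrow> ('m::finite \<Rightarrow> 'h \<Rightarrow> 'k)
    \<Rightarrow> ('m \<Rightarrow> 'h) \<Rightarrow> ('k, 'h, 'm) km_free set set" where
  "km_cartan sc \<alpha> \<alpha>v =
    range (\<lambda>h. lie_coset (free_lie_space (km_scale sc)) (km_relations_ideal sc \<alpha> \<alpha>v)
                 (free_lie_space_incl (km_scale sc) (h, 0, 0)))"

definition trivially_intersecting_ideals :: "('k, 'a) lie_struct \<Rightarrow> 'a set \<Rightarrow> 'a set set" where
  "trivially_intersecting_ideals L H = {I. lie_ideal L I \<and> I \<inter> H = {lie_zero L}}"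

definition km_radical :: "('k::field \<Rightarrow> 'h::ab_group_add \<Rightarrow> 'h) \<Rightarrow> ('m::finite \<Rightarrow> 'h \<Rightarrow> 'k)
    \<Rightarrow> ('m \<Rightarrow> 'h) \<Rightarrow> ('k, 'h, 'm) km_free set set" where
  "km_radical sc \<alpha> \<alpha>v =
    (let \<I> = trivially_intersecting_ideals (km_tilde sc \<alpha> \<alpha>v) (km_cartan sc \<alpha> \<alpha>v)
     in THE I. I \<in> \<I> \<and> (\<forall>J\<in>\<I>. I \<subseteq> J \<longrightarrow> J = I))"

definition kac_moody :: "('k::field \<Rightarrow> 'h::ab_group_add \<Rightarrow> 'h) \<Rightarrow> ('m::finite \<Rightarrow> 'h \<Rightarrow> 'k)
    \<Rightarrow> ('m \<Rightarrow> 'h) \<Rightarrow> ('k, ('k, 'h, 'm) km_free set set) lie_struct" where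
  "kac_moody sc \<alpha> \<alpha>v = lie_quotient (km_tilde sc \<alpha> \<alpha>v) (km_radical sc \<alpha> \<alpha>v)"


section \<open>Generalized Cartan matrices of affine type\<close>

definition generalized_cartan_matrix :: "int^'m^'m \<Rightarrow> bool" where
  "generalized_cartan_matrix B \<longleftrightarrow>
     (\<forall>i. B $ i $ i = 2) \<and>
     (\<forall>i j. i \<noteq> j \<longrightarrow> B $ i $ j \<le> 0) \<and>
     (\<forall>i j. B $ i $ j = 0 \<longrightarrow> B $ j $ i = 0)"

definition indecomposable_matrix :: "'a::zero^'m^'m \<Rightarrow> bool" where
  "indecomposable_matrix M \<longleftrightarrow>
     \<not> (\<exists>S. S \<noteq> {} \<and> S \<noteq> UNIV \<and> (\<forall>i\<in>S. \<forall>j\<in>- S. M $ i $ j = 0 \<and> M $ j $ i = 0))"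

text \<open>Kac's trichotomy (finite, affine, indefinite) for indecomposable real matrices; this is
  his defining condition (Aff).\<close>

definition affine_type :: "real^'m^'m \<Rightarrow> bool" where
  "affine_type M \<longleftrightarrow>
     indecomposable_matrix M \<and>
     rank M + 1 = CARD('m) \<and>
     (\<exists>u. (\<forall>i. u $ i > 0) \<and> M *v u = 0) \<and>
     (\<forall>v. (\<forall>i. (M *v v) $ i \<ge> 0) \<longrightarrow> M *v v = 0)"

definition affine_cartan_matrix :: "'k::field_char_0^'m^'m \<Rightarrow> bool" where
  "affine_cartan_matrix A \<longleftrightarrow>
     (\<exists>B :: int^'m^'m. A = (\<chi> i j. of_int (B $ i $ j)) \<and> generalized_cartan_matrix B \<and>
        affine_type (\<chi> i j. of_int (B $ i $ j)))"

end

theory Submission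
  imports Defs
begin

text \<open>Sending the generators \<open>x\<^bsub>2k-1\<^esub>\<close> and \<open>x\<^bsub>2k\<^esub>\<close> to \<open>y\<^sub>k\<close> and \<open>\<omega> y\<^sub>k\<close> with \<open>\<omega>\<^sup>2 = - 1\<close> makes the
  summands of the Yang-Mills relations cancel in pairs, so every Lie algebra generated by \<open>p\<close>
  elements is a quotient of the Yang-Mills algebra on \<open>n \<ge> 2 p\<close> generators.  It remains to generate
  the algebra of a matrix of size \<open>m\<close> and rank \<open>r\<close> by \<open>max 2 (m - r)\<close> elements.  Take \<open>h\<^sub>0\<close> in the Cartan
  subalgebra on which the roots take values with pairwise distinct squares and all nonzero, and
  complete \<open>h\<^sub>0\<close> and the coroots to a spanning set by \<open>h\<^sub>1, \<dots>, h\<^bsub>m-r-1\<^esub>\<close>.  By a Vandermonde argument the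
  brackets with \<open>h\<^sub>0\<close> extract all \<open>e\<^sub>i\<close> and \<open>f\<^sub>i\<close> from \<open>h\<^sub>1 + \<Sum>\<^sub>i e\<^sub>i + \<Sum>\<^sub>i f\<^sub>i\<close>, and these yield the coroots.
  The ideals meeting the Cartan subalgebra trivially lie in the sum of the nonzero weight spaces, and
  so are closed under sums; hence their union is the radical.\<close>

section \<open>Lie algebras, homomorphisms and generators\<close>

definition lie_subalgebra :: "('k, 'a) lie_struct \<Rightarrow> 'a set \<Rightarrow> bool" where
  "lie_subalgebra L S \<longleftrightarrow>
     S \<subseteq> lie_carrier L \<and> lie_zero L \<in> S \<and>
     (\<forall>a\<in>S. \<forall>b\<in>S. lie_add L a b \<in> S) \<and>
     (\<forall>c. \<forall>a\<in>S. lie_scale L c a \<in> S) \<and>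
     (\<forall>a\<in>S. \<forall>b\<in>S. lie_bracket L a b \<in> S)"

text \<open>Quantifying over all subalgebras that contain \<open>G\<close> turns a proof of
  generation into a closure check and avoids constructing the generated subalgebra.\<close>

definition lie_generated_by :: "('k, 'a) lie_struct \<Rightarrow> 'a set \<Rightarrow> bool" where
  "lie_generated_by L G \<longleftrightarrow>
     G \<subseteq> lie_carrier L \<and> (\<forall>S. lie_subalgebra L S \<longrightarrow> G \<subseteq> S \<longrightarrow> lie_carrier L \<subseteq> S)"

lemma lie_hom_closed: "lie_hom L M \<phi> \<Longrightarrow> a \<in> lie_carrier L \<Longrightarrow> \<phi> a \<in> lie_carrier M"
  and lie_hom_add: "\<lbrakk>lie_hom L M \<phi>; a \<in> lie_carrier L; b \<in> lie_carrier L\<rbrakk>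
    \<Longrightarrow> \<phi> (lie_add L a b) = lie_add M (\<phi> a) (\<phi> b)"
  and lie_hom_scale: "\<lbrakk>lie_hom L M \<phi>; a \<in> lie_carrier L\<rbrakk> \<Longrightarrow> \<phi> (lie_scale L c a) = lie_scale M c (\<phi> a)"
  and lie_hom_bracket: "\<lbrakk>lie_hom L M \<phi>; a \<in> lie_carrier L; b \<in> lie_carrier L\<rbrakk>
    \<Longrightarrow> \<phi> (lie_bracket L a b) = lie_bracket M (\<phi> a) (\<phi> b)"
  unfolding lie_hom_def by blast+

lemma lie_hom_comp: "lie_hom L M \<phi> \<Longrightarrow> lie_hom M N \<psi> \<Longrightarrow> lie_hom L N (\<psi> \<circ> \<phi>)"
  unfolding lie_hom_def by auto

lemma is_lie_quotient_of_trans: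
  assumes "is_lie_quotient_of N M" "is_lie_quotient_of M L"
  shows "is_lie_quotient_of N L"
  using assms unfolding is_lie_quotient_of_def by (metis lie_hom_comp image_comp)

context lie_algebra
begin

lemma zero_add: "a \<in> lie_carrier L \<Longrightarrow> lie_add L (lie_zero L) a = a"
  using add_commute[OF zero_closed] add_zero by metis

lemma add_left_imp_eq:
  assumes "lie_add L a b = lie_add L a d" "a \<in> lie_carrier L" "b \<in> lie_carrier L" "d \<in> lie_carrier L"
  shows "b = d"
proof -
  have "lie_add L (lie_scale L (-1) a) (lie_add L a x) = x" if "x \<in> lie_carrier L" for x
    using that assms(2) add_assoc add_commute add_neg scale_closed zero_add by metis
  then show ?thesis using assms by metis
qed

lemma scale_zero_left: assumes "a \<in> lie_carrier L" shows "lie_scale L 0 a = lie_zero L"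
  using add_scale[OF assms, of 1 "-1"] add_neg[OF assms] scale_one[OF assms] by simp

lemma scale_zero_right: "lie_scale L c (lie_zero L) = lie_zero L"
  using scale_zero_left[OF zero_closed] scale_scale[OF zero_closed, of c 0] by simp

lemma bracket_zero_left: "a \<in> lie_carrier L \<Longrightarrow> lie_bracket L (lie_zero L) a = lie_zero L"
  using scale_zero_left[OF zero_closed] scale_zero_left[OF bracket_closed[OF zero_closed]]
    bracket_scale_left[OF zero_closed] by metis

lemma bracket_zero_right: "a \<in> lie_carrier L \<Longrightarrow> lie_bracket L a (lie_zero L) = lie_zero L"
  using scale_zero_left[OF zero_closed] scale_zero_left[OF bracket_closed[OF _ zero_closed]]
    bracket_scale_right[OF _ zero_closed] by metis

lemma neg_unique:
  assumes "lie_add L a b = lie_zero L" "a \<in> lie_carrier L" "b \<in> lie_carrier L"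
  shows "b = lie_scale L (-1) a"
  using assms add_left_imp_eq add_neg scale_closed by metis

lemma bracket_anti:
  assumes "a \<in> lie_carrier L" "b \<in> lie_carrier L"
  shows "lie_bracket L b a = lie_scale L (-1) (lie_bracket L a b)"
proof (rule neg_unique)
  have "lie_zero L = lie_bracket L (lie_add L a b) (lie_add L a b)"
    using assms by (simp add: bracket_self add_closed)
  also have "\<dots> = lie_add L (lie_bracket L a b) (lie_bracket L b a)"
    using assms by (simp add: bracket_add_left bracket_add_right add_closed bracket_closed
        bracket_self[OF assms(1)] bracket_self[OF assms(2)] zero_add add_zero add_commute)
  finally show "lie_add L (lie_bracket L a b) (lie_bracket L b a) = lie_zero L" ..
qed (use assms in \<open>auto intro: bracket_closed\<close>)

text \<open>The Jacobi identity in the form used throughout: \<open>ad a\<close> is a derivation of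
  the bracket.\<close>

lemma bracket_bracket:
  assumes "a \<in> lie_carrier L" "b \<in> lie_carrier L" "d \<in> lie_carrier L"
  shows "lie_bracket L a (lie_bracket L b d)
    = lie_add L (lie_bracket L (lie_bracket L a b) d) (lie_bracket L b (lie_bracket L a d))"
proof -
  let ?x = "lie_bracket L a (lie_bracket L b d)"
  let ?y = "lie_add L (lie_bracket L b (lie_bracket L d a)) (lie_bracket L d (lie_bracket L a b))"
  have c: "?x \<in> lie_carrier L" "?y \<in> lie_carrier L"
    using assms by (auto intro!: bracket_closed add_closed)
  have "lie_add L ?y ?x = lie_zero L"
    using jacobi[OF assms] add_commute[OF c] by simp
  then have "?x = lie_scale L (-1) ?y"
    using c by (intro neg_unique)
  also have "\<dots> = lie_add L (lie_bracket L b (lie_scale L (-1) (lie_bracket L d a)))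
      (lie_scale L (-1) (lie_bracket L d (lie_bracket L a b)))"
    using assms by (simp add: scale_add bracket_closed bracket_scale_right)
  also have "lie_scale L (-1) (lie_bracket L d a) = lie_bracket L a d"
    using assms by (simp add: bracket_anti[of d a])
  also have "lie_scale L (-1) (lie_bracket L d (lie_bracket L a b)) = lie_bracket L (lie_bracket L a b) d"
    using assms by (simp add: bracket_anti[of d "lie_bracket L a b"] bracket_closed)
  finally show ?thesis using assms by (simp add: add_commute bracket_closed)
qed

lemma lie_sum_simps:
  "lie_sum L f [] = lie_zero L"
  "lie_sum L f (x # xs) = lie_add L (f x) (lie_sum L f xs)"
  by (simp_all add: lie_sum_def)

lemma lie_sum_closed: "(\<And>x. x \<in> set xs \<Longrightarrow> f x \<in> lie_carrier L) \<Longrightarrow> lie_sum L f xs \<in> lie_carrier L"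
  by (induction xs) (auto simp: lie_sum_simps zero_closed add_closed)

lemma lie_sum_append:
  "(\<And>x. x \<in> set xs \<union> set ys \<Longrightarrow> f x \<in> lie_carrier L) \<Longrightarrow>
    lie_sum L f (xs @ ys) = lie_add L (lie_sum L f xs) (lie_sum L f ys)"
  by (induction xs) (auto simp: lie_sum_simps zero_add lie_sum_closed add_assoc)

lemma lie_sum_zero: "(\<And>x. x \<in> set xs \<Longrightarrow> f x = lie_zero L) \<Longrightarrow> lie_sum L f xs = lie_zero L"
  by (induction xs) (auto simp: lie_sum_simps zero_add zero_closed)

lemma lie_hom_zero: assumes "lie_algebra M" "lie_hom L M \<phi>" shows "\<phi> (lie_zero L) = lie_zero M"
proof -
  interpret M: lie_algebra M by fact
  show ?thesis
    using lie_hom_scale[OF assms(2) zero_closed, of 0] scale_zero_right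
      M.scale_zero_left[OF lie_hom_closed[OF assms(2) zero_closed]] by simp
qed

section \<open>Kernels, images and preimages of homomorphisms\<close>

lemma lie_ideal_kernel:
  assumes "lie_algebra M" "lie_hom L M \<phi>"
  shows "lie_ideal L {a \<in> lie_carrier L. \<phi> a = lie_zero M}"
proof -
  interpret M: lie_algebra M by fact
  show ?thesis
    unfolding lie_ideal_def
    by (simp add: lie_hom_closed[OF assms(2)] lie_hom_zero[OF assms] subset_eq
        zero_closed add_closed scale_closed bracket_closed
        lie_hom_add[OF assms(2)] lie_hom_scale[OF assms(2)] lie_hom_bracket[OF assms(2)]
        M.add_zero M.zero_closed M.scale_zero_right M.bracket_zero_right)
qed

lemma lie_subalgebra_image:
  assumes "lie_algebra M" "lie_hom L M \<phi>"
  shows "lie_subalgebra M (\<phi> ` lie_carrier L)"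
proof -
  note c = zero_closed add_closed scale_closed bracket_closed
  have "lie_zero M \<in> \<phi> ` lie_carrier L"
    using lie_hom_zero[OF assms] zero_closed by (metis imageI)
  then show ?thesis
    unfolding lie_subalgebra_def
    by (simp add: lie_hom_closed[OF assms(2)] subset_eq c imageI
        lie_hom_add[OF assms(2), symmetric] lie_hom_scale[OF assms(2), symmetric]
        lie_hom_bracket[OF assms(2), symmetric])
qed

lemma lie_subalgebra_vimage:
  assumes "lie_algebra M" "lie_hom L M \<phi>" "lie_subalgebra M S"
  shows "lie_subalgebra L {a \<in> lie_carrier L. \<phi> a \<in> S}"
  using assms(3) lie_hom_zero[OF assms(1,2)]
  by (auto simp: lie_subalgebra_def zero_closed add_closed scale_closed bracket_closed
        lie_hom_add[OF assms(2)] lie_hom_scale[OF assms(2)] lie_hom_bracket[OF assms(2)])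

text \<open>The preimage of a subalgebra containing the images of \<open>G\<close> is a subalgebra
  containing \<open>G\<close>, hence everything; surjectivity of \<open>\<phi>\<close> then
  finishes.\<close>

lemma lie_generated_by_image:
  assumes "lie_algebra M" "lie_hom L M \<phi>" "\<phi> ` lie_carrier L = lie_carrier M" "lie_generated_by L G"
  shows "lie_generated_by M (\<phi> ` G)"
  unfolding lie_generated_by_def
proof (intro conjI allI impI)
  show "\<phi> ` G \<subseteq> lie_carrier M" using assms(3,4) unfolding lie_generated_by_def by blast
  fix S assume S: "lie_subalgebra M S" "\<phi> ` G \<subseteq> S"
  have "G \<subseteq> {a \<in> lie_carrier L. \<phi> a \<in> S}" using assms(4) S(2) unfolding lie_generated_by_def by blast
  then have "lie_carrier L \<subseteq> {a \<in> lie_carrier L. \<phi> a \<in> S}"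
    using assms(4) lie_subalgebra_vimage[OF assms(1,2) S(1)] unfolding lie_generated_by_def by blast
  then show "lie_carrier M \<subseteq> S" unfolding assms(3)[symmetric] by auto
qed

section \<open>Quotients by ideals\<close>

lemma lie_hom_lie_coset: assumes "lie_ideal L I" shows "lie_hom L (lie_quotient L I) (lie_coset L I)"
  unfolding lie_hom_def using lie_coset_simps[OF assms] by (auto simp: lie_quotient_def)

lemma lie_quotient_carrier: "lie_carrier (lie_quotient L I) = lie_coset L I ` lie_carrier L"
  by (simp add: lie_quotient_def)

lemma is_lie_quotient_of_lie_quotient: "lie_ideal L I \<Longrightarrow> is_lie_quotient_of (lie_quotient L I) L"
  unfolding is_lie_quotient_of_def
  by (intro exI[of _ "lie_coset L I"]) (simp add: lie_hom_lie_coset lie_quotient_carrier)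

text \<open>Relators are written as differences, so this is what turns a relator in the ideal into
  an equation in the quotient.\<close>

lemma lie_coset_eqI:
  assumes "lie_ideal L I" "a \<in> lie_carrier L" "b \<in> lie_carrier L" "lie_minus L a b \<in> I"
  shows "lie_coset L I a = lie_coset L I b"
proof (rule lie_coset_eq[OF assms(1,3)])
  have "a = lie_add L b (lie_minus L a b)"
    unfolding lie_minus_def using assms(2,3) by (metis add_left_commute add_neg add_zero scale_closed)
  then show "a \<in> lie_coset L I b" using assms(4) unfolding lie_coset_def by blast
qed

lemma lie_coset_zeroI:
  assumes "lie_ideal L I" "a \<in> I" shows "lie_coset L I a = lie_zero (lie_quotient L I)"
proof -
  have a: "a \<in> lie_carrier L" using assms by (auto simp: lie_ideal_def)
  have "lie_coset L I a = lie_coset L I (lie_zero L)"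
    using assms a zero_closed
    by (intro lie_coset_eqI) (auto simp: lie_minus_def scale_zero_right add_zero)
  then show ?thesis by (simp add: lie_quotient_def)
qed

lemma lie_quotient_induced_hom:
  assumes "lie_algebra M" "lie_ideal L I" "lie_hom L M \<phi>" "\<And>i. i \<in> I \<Longrightarrow> \<phi> i = lie_zero M"
  obtains \<psi> where "lie_hom (lie_quotient L I) M \<psi>"
    "\<And>a. a \<in> lie_carrier L \<Longrightarrow> \<psi> (lie_coset L I a) = \<phi> a"
proof
  interpret M: lie_algebra M by fact
  \<comment> \<open>A homomorphism that vanishes on \<open>I\<close> is constant on each coset, so
    the image of a coset is a singleton and \<open>the_elem\<close> reads off its value.\<close>
  define \<psi> where "\<psi> P = the_elem (\<phi> ` P)" for P
  have sub: "I \<subseteq> lie_carrier L" using assms(2) by (simp add: lie_ideal_def)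
  have eq: "\<psi> (lie_coset L I a) = \<phi> a" if a: "a \<in> lie_carrier L" for a
  proof -
    have "\<phi> x = \<phi> a" if "x \<in> lie_coset L I a" for x
      using that a sub lie_hom_closed[OF assms(3) a]
      by (auto simp: lie_coset_def lie_hom_add[OF assms(3)] assms(4) M.add_zero subset_iff)
    then have "\<phi> ` lie_coset L I a = {\<phi> a}"
      using lie_coset_self[OF assms(2) a] by blast
    then show ?thesis by (simp add: \<psi>_def)
  qed
  then show "\<And>a. a \<in> lie_carrier L \<Longrightarrow> \<psi> (lie_coset L I a) = \<phi> a" .
  note h = lie_hom_lie_coset[OF assms(2)]
  show "lie_hom (lie_quotient L I) M \<psi>"
    unfolding lie_hom_def lie_quotient_carrier
    using lie_hom_closed[OF assms(3)]
    by (auto simp: eq lie_hom_add[OF h, symmetric] lie_hom_scale[OF h, symmetric]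
        lie_hom_bracket[OF h, symmetric] add_closed scale_closed bracket_closed
        lie_hom_add[OF assms(3)] lie_hom_scale[OF assms(3)] lie_hom_bracket[OF assms(3)])
qed

end

section \<open>The universal property of the free Lie algebra\<close>

lemma free_lie_hom_simps:
  "s \<in> lie_terms X \<Longrightarrow> t \<in> lie_terms X \<Longrightarrow>
     lie_add (free_lie X) (lie_class X s) (lie_class X t) = lie_class X (Plus s t)"
  "s \<in> lie_terms X \<Longrightarrow> t \<in> lie_terms X \<Longrightarrow>
     lie_bracket (free_lie X) (lie_class X s) (lie_class X t) = lie_class X (Bracket s t)"
  "s \<in> lie_terms X \<Longrightarrow> lie_scale (free_lie X) c (lie_class X s) = lie_class X (Scale c s)"
  "lie_zero (free_lie X) = lie_class X Zero"
  "lie_carrier (free_lie X) = lie_class X ` lie_terms X"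
  using lie_class_simps[of s X t] lie_class_simps[of s X s]
  by (simp_all add: free_lie_def)

lemma free_lie_gen_closed: "x \<in> X \<Longrightarrow> free_lie_gen X x \<in> lie_carrier (free_lie X)"
  by (auto simp: free_lie_gen_def free_lie_hom_simps lie_terms_simps)

text \<open>Evaluation of Lie expressions in \<open>L\<close> respects \<open>lie_eq\<close>, so it
  descends to the classes that make up the free Lie algebra.\<close>

lemma free_lie_induced_hom:
  fixes L :: "('k::field, 'a) lie_struct"
  assumes L: "lie_algebra L" and g: "g ` X \<subseteq> lie_carrier L"
  obtains \<phi> where "lie_hom (free_lie X) L \<phi>" "\<And>x. x \<in> X \<Longrightarrow> \<phi> (free_lie_gen X x) = g x"
proof
  define \<phi> where "\<phi> P = the_elem (lie_eval L g ` P)" for P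
  have eq: "\<phi> (lie_class X t) = lie_eval L g t" if t: "t \<in> lie_terms X" for t
  proof -
    have "t \<in> lie_class X t" using t by (auto simp: lie_class_def intro: lie_eq.refl)
    moreover have "lie_eval L g s = lie_eval L g t" if "s \<in> lie_class X t" for s
      using that lie_eval_cong[OF L g, of t s] by (simp add: lie_class_def)
    ultimately have "lie_eval L g ` lie_class X t = {lie_eval L g t}" by blast
    then show ?thesis by (simp add: \<phi>_def)
  qed
  then show "\<And>x. x \<in> X \<Longrightarrow> \<phi> (free_lie_gen X x) = g x"
    by (simp add: free_lie_gen_def lie_terms_simps)
  show "lie_hom (free_lie X) L \<phi>"
    unfolding lie_hom_def
    by (auto simp: free_lie_hom_simps eq lie_terms_simps lie_eval_closed[OF L g])
qed

lemma lie_generated_by_free_lie: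
  "lie_generated_by (free_lie X :: ('k::field, ('k, 'x) lie_term set) lie_struct) (free_lie_gen X ` X)"
  unfolding lie_generated_by_def
proof (intro conjI allI impI)
  show "free_lie_gen X ` X \<subseteq> lie_carrier (free_lie X :: ('k, ('k, 'x) lie_term set) lie_struct)"
    by (auto intro: free_lie_gen_closed)
  fix S :: "('k, 'x) lie_term set set"
  assume S: "lie_subalgebra (free_lie X) S" "free_lie_gen X ` X \<subseteq> S"
  have "lie_class X t \<in> S" if "t \<in> lie_terms X" for t
    using that
  proof (induction t)
    case (Gen x)
    then show ?case using S(2) by (auto simp: lie_terms_simps free_lie_gen_def)
  next
    case Zero
    then show ?case using S(1) by (simp add: lie_subalgebra_def free_lie_hom_simps(4))
  next
    case (Plus s t)
    then have "s \<in> lie_terms X" "t \<in> lie_terms X" by (simp_all add: lie_terms_simps)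
    then show ?case
      using Plus.IH S(1) free_lie_hom_simps(1)[of s X t] unfolding lie_subalgebra_def by metis
  next
    case (Scale c s)
    then have "s \<in> lie_terms X" by (simp add: lie_terms_simps)
    then show ?case
      using Scale.IH S(1) free_lie_hom_simps(3)[of s X c] unfolding lie_subalgebra_def by metis
  next
    case (Bracket s t)
    then have "s \<in> lie_terms X" "t \<in> lie_terms X" by (simp_all add: lie_terms_simps)
    then show ?case
      using Bracket.IH S(1) free_lie_hom_simps(2)[of s X t] unfolding lie_subalgebra_def by metis
  qed
  then show "lie_carrier (free_lie X) \<subseteq> S" by (auto simp: free_lie_hom_simps(5))
qed

section \<open>Quotients of Yang-Mills algebras\<close>

lemma is_lie_quotient_of_yang_mills:
  fixes L :: "('k::field, 'a) lie_struct"
  assumes L: "lie_algebra L" and gen: "lie_generated_by L (y ` {..<p})" and n: "2 * p \<le> n"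
    and \<omega>: "\<omega> * \<omega> = (-1 :: 'k)"
  shows "is_lie_quotient_of L (yang_mills n)"
proof -
  interpret lie_algebra L by fact
  define X where "X = {1..n}"
  \<comment> \<open>Generators are numbered from 1 and the \<open>y k\<close> from 0: the pair
    \<open>2 * k + 1\<close>, \<open>2 * k + 2\<close> goes to \<open>y k\<close> and
    \<open>\<omega>\<close> times \<open>y k\<close>. Surplus generators go to zero; the value at 0
    is a default that keeps \<open>g\<close> in the carrier.\<close>
  define g where "g i = (if i = 0 \<or> 2 * p < i then lie_zero L
    else if odd i then y (i div 2) else lie_scale L \<omega> (y (i div 2 - 1)))" for i
  have y: "y k \<in> lie_carrier L" if "k < p" for k
    using gen that by (auto simp: lie_generated_by_def)
  have g: "g i \<in> lie_carrier L" for i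
    unfolding g_def by (auto intro!: zero_closed y scale_closed elim!: oddE)
  let ?F = "free_lie X :: ('k, ('k, nat) lie_term set) lie_struct"
  interpret F: lie_algebra ?F by (rule lie_algebra_free_lie)
  obtain \<phi> where \<phi>: "lie_hom ?F L \<phi>" "\<And>x. x \<in> X \<Longrightarrow> \<phi> (free_lie_gen X x) = g x"
    using free_lie_induced_hom[OF L, of g X] g by blast
  let ?R = "yang_mills_relator n ` X :: ('k, nat) lie_term set set"
  let ?I = "lie_ideal_generated ?F ?R"
  have hom_sum: "\<phi> (lie_sum ?F f xs) = lie_sum L (\<lambda>i. \<phi> (f i)) xs"
    if "\<And>i. i \<in> set xs \<Longrightarrow> f i \<in> lie_carrier ?F" for f and xs :: "nat list"
    using that
    by (induction xs) (simp_all add: lie_sum_simps F.lie_sum_simps F.lie_hom_zero[OF L \<phi>(1)]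
        lie_hom_add[OF \<phi>(1)] F.lie_sum_closed)
  have pairs: "lie_sum L (\<lambda>i. lie_bracket L (g i) (lie_bracket L (g i) z)) [1..<Suc (2 * q)] = lie_zero L"
    if z: "z \<in> lie_carrier L" and "q \<le> p" for z q
    using that(2)
  proof (induction q)
    case 0
    then show ?case by (simp add: lie_sum_simps)
  next
    case (Suc q)
    let ?T = "\<lambda>i. lie_bracket L (g i) (lie_bracket L (g i) z)"
    have T: "?T i \<in> lie_carrier L" for i using g z bracket_closed by blast
    \<comment> \<open>The double bracket is quadratic in \<open>g i\<close>, so the factor
      \<open>\<omega>\<close> contributes \<open>\<omega> * \<omega> = -1\<close> and the two
      members of a pair cancel.\<close>
    have "?T (2 * q + 2) = lie_scale L (-1) (?T (2 * q + 1))"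
    proof -
      have "g (2 * q + 2) = lie_scale L \<omega> (g (2 * q + 1))"
        using Suc.prems by (simp add: g_def)
      then show ?thesis
        using g[of "2 * q + 1"] z
        by (simp add: bracket_scale_left bracket_scale_right bracket_closed scale_closed scale_scale \<omega>)
    qed
    then have 2: "lie_sum L ?T [2 * q + 1, 2 * q + 2] = lie_zero L"
      using T[of "2 * q + 1"] by (simp add: lie_sum_simps add_neg add_zero scale_closed)
    have split: "[1..<Suc (2 * Suc q)] = [1..<Suc (2 * q)] @ [2 * q + 1, 2 * q + 2]"
      by simp
    show ?case
      unfolding split using Suc 2 by (simp add: lie_sum_append T add_zero zero_closed)
  qed
  have rel: "\<phi> r = lie_zero L" and r_closed: "r \<in> lie_carrier ?F" if r_in: "r \<in> ?R" for r
  proof -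
    obtain j where j: "j \<in> X" "r = yang_mills_relator n j" using r_in by blast
    let ?x = "free_lie_gen X :: nat \<Rightarrow> ('k, nat) lie_term set"
    let ?t = "\<lambda>i. lie_bracket ?F (?x i) (lie_bracket ?F (?x i) (?x j))"
    have r: "r = lie_sum ?F ?t [1..<Suc n]"
      unfolding j(2) yang_mills_relator_def Let_def X_def ..
    have x: "?x i \<in> lie_carrier ?F" if "i \<in> X" for i using that by (rule free_lie_gen_closed)
    have t: "?t i \<in> lie_carrier ?F" "\<phi> (?t i) = lie_bracket L (g i) (lie_bracket L (g i) (g j))"
      if "i \<in> X" for i
      using x[OF that] x[OF j(1)] \<phi>(2)[OF that] \<phi>(2)[OF j(1)]
      by (simp_all add: F.bracket_closed lie_hom_bracket[OF \<phi>(1)])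
    have set: "set [1..<Suc n] = X" by (auto simp: X_def)
    show "r \<in> lie_carrier ?F" unfolding r using t set by (intro F.lie_sum_closed) blast
    have "\<phi> r = lie_sum L (\<lambda>i. \<phi> (?t i)) [1..<Suc n]"
      unfolding r using t set by (intro hom_sum) blast
    also have "\<dots> = lie_sum L (\<lambda>i. lie_bracket L (g i) (lie_bracket L (g i) (g j))) [1..<Suc n]"
      unfolding lie_sum_def using t(2) set by (intro foldr_cong) auto
    \<comment> \<open>The first segment consists of full pairs; on the second one \<open>g\<close>
      is zero.\<close>
    also have "[1..<Suc n] = [1..<Suc (2 * p)] @ [Suc (2 * p)..<Suc n]"
      using n upt_add_eq_append[of 1 "Suc (2 * p)" "n - 2 * p"] by simp
    also have "lie_sum L (\<lambda>i. lie_bracket L (g i) (lie_bracket L (g i) (g j))) \<dots> = lie_zero L"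
    proof -
      have "lie_sum L (\<lambda>i. lie_bracket L (g i) (lie_bracket L (g i) (g j))) [Suc (2 * p)..<Suc n] = lie_zero L"
        using g by (intro lie_sum_zero) (auto simp: g_def[of "_::nat"] bracket_zero_left zero_closed)
      then show ?thesis
        using pairs[OF g order_refl] by (simp add: lie_sum_append g bracket_closed add_zero zero_closed)
    qed
    finally show "\<phi> r = lie_zero L" .
  qed
  have I: "lie_ideal ?F ?I"
    using r_closed by (intro F.lie_ideal_lie_ideal_generated) blast
  \<comment> \<open>The kernel of \<open>\<phi>\<close> is an ideal containing the relators, hence
    contains the ideal they generate, and \<open>\<phi>\<close> factors through the Yang-Mills
    algebra.\<close>
  have "?I \<subseteq> {a \<in> lie_carrier ?F. \<phi> a = lie_zero L}"
    unfolding lie_ideal_generated_def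
    using F.lie_ideal_kernel[OF L \<phi>(1)] rel r_closed by (intro Inter_lower) blast
  then obtain \<psi> where \<psi>: "lie_hom (yang_mills n) L \<psi>"
    "\<And>a. a \<in> lie_carrier ?F \<Longrightarrow> \<psi> (lie_coset ?F ?I a) = \<phi> a"
    using F.lie_quotient_induced_hom[OF L I \<phi>(1)] unfolding yang_mills_def X_def[symmetric] by blast
  interpret Y: lie_algebra "yang_mills n :: ('k, ('k, nat) lie_term set set) lie_struct"
    unfolding yang_mills_def X_def[symmetric] using I by (rule F.lie_algebra_lie_quotient)
  \<comment> \<open>Surjectivity: the image is a subalgebra, and the generators of odd index already
    hit every \<open>y k\<close>.\<close>
  have im: "lie_subalgebra L (\<psi> ` lie_carrier (yang_mills n))"
    using Y.lie_subalgebra_image[OF L \<psi>(1)] .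
  have "y k \<in> \<psi> ` lie_carrier (yang_mills n)" if "k < p" for k
  proof -
    have k: "2 * k + 1 \<in> X" using that n by (auto simp: X_def)
    have "\<psi> (lie_coset ?F ?I (free_lie_gen X (2 * k + 1))) = y k"
      using \<psi>(2)[OF free_lie_gen_closed[OF k]] \<phi>(2)[OF k] that by (simp add: g_def)
    moreover have "lie_coset ?F ?I (free_lie_gen X (2 * k + 1)) \<in> lie_carrier (yang_mills n)"
      unfolding yang_mills_def X_def[symmetric] F.lie_quotient_carrier using free_lie_gen_closed[OF k] by blast
    ultimately show ?thesis by (metis imageI)
  qed
  then have "lie_carrier L \<subseteq> \<psi> ` lie_carrier (yang_mills n)"
    using gen im unfolding lie_generated_by_def by blast
  then show ?thesis
    unfolding is_lie_quotient_of_def using \<psi>(1) im by (auto simp: lie_subalgebra_def)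
qed

section \<open>Eigenvectors of an inner derivation\<close>

text \<open>This is the operator \<open>ad d - k\<close>. Folding it over a list \<open>ks\<close>
  applies a polynomial in \<open>ad d\<close> whose roots, with multiplicity, are the entries of
  \<open>ks\<close>.\<close>

definition lie_shift :: "('k::field, 'a) lie_struct \<Rightarrow> 'a \<Rightarrow> 'k \<Rightarrow> 'a \<Rightarrow> 'a" where
  "lie_shift L d k x = lie_add L (lie_bracket L d x) (lie_scale L (- k) x)"

context lie_algebra
begin

lemma lie_shift_closed:
  "d \<in> lie_carrier L \<Longrightarrow> x \<in> lie_carrier L \<Longrightarrow> lie_shift L d k x \<in> lie_carrier L"
  by (simp add: lie_shift_def add_closed bracket_closed scale_closed)

lemma lie_shift_add:
  assumes "d \<in> lie_carrier L" "x \<in> lie_carrier L" "y \<in> lie_carrier L"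
  shows "lie_shift L d k (lie_add L x y) = lie_add L (lie_shift L d k x) (lie_shift L d k y)"
  using assms by (simp add: lie_shift_def bracket_add_right scale_add add_closed bracket_closed
      scale_closed add_assoc add_left_commute)

lemma lie_shift_scale:
  assumes "d \<in> lie_carrier L" "x \<in> lie_carrier L"
  shows "lie_shift L d k (lie_scale L c x) = lie_scale L c (lie_shift L d k x)"
  using assms by (simp add: lie_shift_def bracket_scale_right scale_add bracket_closed
      scale_closed scale_scale mult.commute)

lemma lie_shift_zero: "d \<in> lie_carrier L \<Longrightarrow> lie_shift L d k (lie_zero L) = lie_zero L"
  by (simp add: lie_shift_def bracket_zero_right scale_zero_right add_zero zero_closed)

lemma lie_shift_commute:
  assumes "d \<in> lie_carrier L" "x \<in> lie_carrier L"
  shows "lie_shift L d k (lie_shift L d l x) = lie_shift L d l (lie_shift L d k x)"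
proof -
  have "lie_shift L d k (lie_shift L d l x)
      = lie_add L (lie_shift L d k (lie_bracket L d x)) (lie_scale L (- l) (lie_shift L d k x))"
    using assms lie_shift_add[of d "lie_bracket L d x" "lie_scale L (- l) x" k]
    by (simp add: lie_shift_def[of L d l] bracket_closed scale_closed lie_shift_scale)
  also have "lie_shift L d k (lie_bracket L d x) = lie_bracket L d (lie_shift L d k x)"
    using assms by (simp add: lie_shift_def bracket_add_right bracket_scale_right bracket_closed scale_closed)
  finally show ?thesis by (simp add: lie_shift_def[of L d l])
qed

lemma lie_shifts_closed:
  "d \<in> lie_carrier L \<Longrightarrow> x \<in> lie_carrier L \<Longrightarrow> fold (lie_shift L d) ks x \<in> lie_carrier L"
  by (induction ks arbitrary: x) (auto simp: lie_shift_closed)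

lemma lie_shifts_add:
  "\<lbrakk>d \<in> lie_carrier L; x \<in> lie_carrier L; y \<in> lie_carrier L\<rbrakk> \<Longrightarrow>
    fold (lie_shift L d) ks (lie_add L x y)
    = lie_add L (fold (lie_shift L d) ks x) (fold (lie_shift L d) ks y)"
  by (induction ks arbitrary: x y) (auto simp: lie_shift_closed lie_shift_add)

lemma lie_shifts_scale:
  "\<lbrakk>d \<in> lie_carrier L; x \<in> lie_carrier L\<rbrakk> \<Longrightarrow>
    fold (lie_shift L d) ks (lie_scale L c x) = lie_scale L c (fold (lie_shift L d) ks x)"
  by (induction ks arbitrary: x) (auto simp: lie_shift_closed lie_shift_scale)

lemma lie_shifts_zero: "d \<in> lie_carrier L \<Longrightarrow> fold (lie_shift L d) ks (lie_zero L) = lie_zero L"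
  by (induction ks) (auto simp: lie_shift_zero)

lemma lie_shifts_shift:
  "\<lbrakk>d \<in> lie_carrier L; x \<in> lie_carrier L\<rbrakk> \<Longrightarrow>
    fold (lie_shift L d) ks (lie_shift L d k x) = lie_shift L d k (fold (lie_shift L d) ks x)"
  by (induction ks arbitrary: x) (simp_all add: lie_shift_closed lie_shift_commute[of d _ _ k])

lemma lie_shifts_commute:
  "\<lbrakk>d \<in> lie_carrier L; x \<in> lie_carrier L\<rbrakk> \<Longrightarrow>
    fold (lie_shift L d) ks (fold (lie_shift L d) ls x) = fold (lie_shift L d) ls (fold (lie_shift L d) ks x)"
  by (induction ls arbitrary: x) (simp_all add: lie_shift_closed lie_shifts_shift lie_shifts_closed)

text \<open>The product of two annihilating polynomials annihilates the sum: the factors commute, so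
  each summand can meet its own factor first.\<close>

lemma lie_shifts_kill_add:
  assumes "d \<in> lie_carrier L" "x \<in> lie_carrier L" "y \<in> lie_carrier L"
    and "fold (lie_shift L d) ks x = lie_zero L" "fold (lie_shift L d) ls y = lie_zero L"
  shows "fold (lie_shift L d) (ks @ ls) (lie_add L x y) = lie_zero L"
  using assms by (simp add: lie_shifts_add lie_shifts_closed lie_shifts_commute[of d y ls]
      lie_shifts_zero add_zero zero_closed)

text \<open>On the kernel of \<open>ad d\<close> the operator \<open>ad d - k\<close> is
  multiplication by \<open>- k\<close>. With no zero in \<open>ks\<close> the resulting scalar is
  nonzero, which is how the Cartan part of an element is isolated later.\<close>

lemma lie_shifts_kernel:
  assumes "d \<in> lie_carrier L" "x \<in> lie_carrier L" "lie_bracket L d x = lie_zero L"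
  shows "fold (lie_shift L d) ks x = lie_scale L (\<Prod>k\<leftarrow>ks. - k) x"
proof (induction ks)
  case (Cons k ks)
  have "lie_shift L d k x = lie_scale L (- k) x"
    using assms by (simp add: lie_shift_def zero_add scale_closed)
  then show ?case using assms Cons by (simp add: lie_shifts_scale scale_scale)
qed (use assms in \<open>simp add: scale_one\<close>)

lemma scale_mem_cancel:
  assumes "\<And>c x. x \<in> S \<Longrightarrow> lie_scale L c x \<in> S" "x \<in> lie_carrier L" "c \<noteq> 0" "lie_scale L c x \<in> S"
  shows "x \<in> S"
  using assms(1)[OF assms(4), of "inverse c"] assms(2,3) by (simp add: scale_scale scale_one)

text \<open>The Vandermonde argument as an induction. Applying \<open>ad d - \<mu> x0\<close> to the
  sum removes the first eigenvector and multiplies the others by nonzero differences of eigenvalues;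
  once the others are known to lie in \<open>S\<close>, subtracting them recovers the first.\<close>

lemma eigenvectors_mem_lie_subalgebra:
  assumes S: "lie_subalgebra L S" and d: "d \<in> S"
    and "distinct xs" "inj_on \<mu> (set xs)"
    and "\<And>x. x \<in> set xs \<Longrightarrow> v x \<in> lie_carrier L"
    and "\<And>x. x \<in> set xs \<Longrightarrow> lie_bracket L d (v x) = lie_scale L (\<mu> x) (v x)"
    and "lie_sum L v xs \<in> S" and "x \<in> set xs"
  shows "v x \<in> S"
proof -
  note S' = S[unfolded lie_subalgebra_def]
  have dc: "d \<in> lie_carrier L" using S' d by blast
  have "\<forall>x\<in>set xs. v x \<in> S" using assms(3-7)
  proof (induction xs arbitrary: v)
    case (Cons x0 xs)
    \<comment> \<open>The shifted family: again eigenvectors with the same eigenvalues, which is why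
      the induction lets \<open>v\<close> vary.\<close>
    define w where "w x = lie_scale L (\<mu> x - \<mu> x0) (v x)" for x
    have v: "v x \<in> lie_carrier L" if "x \<in> set (x0 # xs)" for x using Cons.prems(3) that by blast
    have shift: "lie_shift L d (\<mu> x0) (v x) = w x" if "x \<in> set (x0 # xs)" for x
      using Cons.prems(4)[OF that] v[OF that]
      by (simp add: lie_shift_def w_def add_scale[symmetric])
    have "lie_shift L d (\<mu> x0) (lie_sum L v ys) = lie_sum L w ys" if "set ys \<subseteq> set (x0 # xs)" for ys
      using that
    proof (induction ys)
      case (Cons y ys)
      then show ?case
        using v shift dc by (simp add: lie_sum_simps lie_shift_add lie_sum_closed subset_eq)
    qed (use dc in \<open>simp add: lie_sum_simps lie_shift_zero\<close>)
    from this[of "x0 # xs"] have "lie_sum L w (x0 # xs) = lie_shift L d (\<mu> x0) (lie_sum L v (x0 # xs))"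
      by simp
    also have "\<dots> \<in> S" using Cons.prems(5) S' d by (simp add: lie_shift_def)
    finally have "lie_sum L w (x0 # xs) \<in> S" .
    moreover have "w x0 = lie_zero L" using v by (simp add: w_def scale_zero_left)
    moreover have w: "w x \<in> lie_carrier L" if "x \<in> set xs" for x
      using v that by (simp add: w_def scale_closed)
    ultimately have "lie_sum L w xs \<in> S" by (simp add: lie_sum_simps zero_add lie_sum_closed)
    moreover have "lie_bracket L d (w x) = lie_scale L (\<mu> x) (w x)" if "x \<in> set xs" for x
      using Cons.prems(4)[of x] v[of x] that dc
      by (simp add: w_def bracket_scale_right scale_scale mult.commute)
    ultimately have "\<forall>x\<in>set xs. w x \<in> S"
      using Cons.IH[of w] Cons.prems(1,2) w by simp
    then have vS: "v x \<in> S" if "x \<in> set xs" for x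
    proof (intro scale_mem_cancel[of S "v x" "\<mu> x - \<mu> x0"])
      show "\<mu> x - \<mu> x0 \<noteq> 0" using Cons.prems(1,2) that by (auto simp: inj_on_def)
    qed (use S' v that in \<open>auto simp: w_def\<close>)
    have sumS: "lie_sum L v xs \<in> S"
      using vS S' by (induction xs) (simp_all add: lie_sum_simps)
    have "v x0 = lie_add L (lie_sum L v (x0 # xs)) (lie_scale L (-1) (lie_sum L v xs))"
      using v by (simp add: lie_sum_simps add_assoc lie_sum_closed scale_closed add_neg add_zero)
    then have "v x0 \<in> S" using Cons.prems(5) sumS S' by simp
    then show ?case using vS by simp
  qed simp
  then show ?thesis using assms(8) by blast
qed

end

section \<open>The triangular decomposition\<close>

text \<open>One half of the triangular decomposition, to be used twice: as it stands for the
  positive half, and with \<open>E\<close> and \<open>F\<close> exchanged and the roots negated for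
  the negative half. \<open>FE\<close> only asks for a value in the Cartan part, a condition that is
  symmetric under this exchange.\<close>

locale triangular_half = lie_algebra L
  for L :: "('k::field_char_0, 'a) lie_struct" +
  fixes sc :: "'k \<Rightarrow> 'h::ab_group_add \<Rightarrow> 'h"
    and H :: "'h \<Rightarrow> 'a" and E F :: "'m \<Rightarrow> 'a" and a :: "'m \<Rightarrow> 'h \<Rightarrow> 'k"
  assumes H_closed: "H h \<in> lie_carrier L"
    and E_closed: "E i \<in> lie_carrier L"
    and F_closed: "F i \<in> lie_carrier L"
    and H_add: "H (h + h') = lie_add L (H h) (H h')"
    and H_scale: "H (sc c h) = lie_scale L c (H h)"
    and HE: "lie_bracket L (H h) (E i) = lie_scale L (a i h) (E i)"
    and FE: "\<exists>h. lie_bracket L (F j) (E i) = H h"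
begin

text \<open>The span of the right-nested brackets of the \<open>E i\<close>. Only a single generator
  may stand on the left in \<open>brack\<close>, so that induction peels off one generator at a
  time.\<close>

inductive_set nilp :: "'a set" where
  gen: "E i \<in> nilp"
| brack: "x \<in> nilp \<Longrightarrow> lie_bracket L (E i) x \<in> nilp"
| zero: "lie_zero L \<in> nilp"
| add: "x \<in> nilp \<Longrightarrow> y \<in> nilp \<Longrightarrow> lie_add L x y \<in> nilp"
| scale: "x \<in> nilp \<Longrightarrow> lie_scale L c x \<in> nilp"

lemma nilp_closed: "x \<in> nilp \<Longrightarrow> x \<in> lie_carrier L"
  by (induction rule: nilp.induct)
    (auto intro: E_closed zero_closed add_closed scale_closed bracket_closed)

lemma H_zero: "H 0 = lie_zero L"
  using H_add[of 0 0] add_left_imp_eq[of "H 0" "H 0" "lie_zero L"] H_closed[of 0]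
  by (simp add: add_zero zero_closed)

lemma bracket_H_nilp: "x \<in> nilp \<Longrightarrow> lie_bracket L (H h) x \<in> nilp"
proof (induction rule: nilp.induct)
  case (gen i)
  then show ?case by (simp add: HE nilp.intros)
next
  case (brack x i)
  have "lie_bracket L (H h) (lie_bracket L (E i) x)
      = lie_add L (lie_scale L (a i h) (lie_bracket L (E i) x)) (lie_bracket L (E i) (lie_bracket L (H h) x))"
    using nilp_closed[OF brack(1)] H_closed[of h] E_closed[of i]
    by (simp add: bracket_bracket[of "H h"] HE bracket_scale_left)
  then show ?case using brack by (simp add: nilp.intros)
qed (simp_all add: bracket_zero_right bracket_add_right bracket_scale_right H_closed nilp_closed nilp.intros)

text \<open>\<open>ad (F j)\<close> is a derivation sending each \<open>E i\<close> into the Cartan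
  part. In a longer bracket a Cartan term is always bracketed once more with an element of
  \<open>nilp\<close> and so falls back into \<open>nilp\<close>.\<close>

lemma bracket_F_nilp: "x \<in> nilp \<Longrightarrow> \<exists>h. \<exists>y\<in>nilp. lie_bracket L (F j) x = lie_add L (H h) y"
proof (induction rule: nilp.induct)
  case (gen i)
  show ?case using FE[of j i] nilp.zero add_zero H_closed by metis
next
  case (brack x i)
  obtain h' where h': "lie_bracket L (F j) (E i) = H h'" using FE by blast
  obtain h y where hy: "y \<in> nilp" "lie_bracket L (F j) x = lie_add L (H h) y" using brack.IH by blast
  have "lie_bracket L (E i) (H h) = lie_scale L (- a i h) (E i)"
    using bracket_anti[OF H_closed E_closed, of i h] by (simp add: HE scale_scale E_closed)
  then have "lie_bracket L (F j) (lie_bracket L (E i) x)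
      = lie_add L (lie_bracket L (H h') x) (lie_add L (lie_scale L (- a i h) (E i)) (lie_bracket L (E i) y))"
    using nilp_closed[OF brack(1)] nilp_closed[OF hy(1)] H_closed E_closed F_closed
    by (simp add: bracket_bracket[of "F j"] h' hy(2) bracket_add_right)
  then have "lie_bracket L (F j) (lie_bracket L (E i) x) \<in> nilp"
    using bracket_H_nilp[OF brack(1)] hy(1) by (simp add: nilp.intros)
  then show ?case using H_zero nilp_closed zero_add by metis
next
  case zero
  show ?case
    by (rule exI[of _ 0], rule bexI[OF _ nilp.zero])
      (simp add: H_zero bracket_zero_right F_closed add_zero zero_closed)
next
  case (add x y)
  then obtain h z h' z' where *: "z \<in> nilp" "lie_bracket L (F j) x = lie_add L (H h) z"
    "z' \<in> nilp" "lie_bracket L (F j) y = lie_add L (H h') z'" by blast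
  have "lie_bracket L (F j) (lie_add L x y) = lie_add L (H (h + h')) (lie_add L z z')"
    using * add by (simp add: bracket_add_right F_closed nilp_closed H_add add_assoc H_closed
        add_closed add_left_commute)
  then show ?case using *(1,3) nilp.add by blast
next
  case (scale x c)
  then obtain h z where *: "z \<in> nilp" "lie_bracket L (F j) x = lie_add L (H h) z" by blast
  have "lie_bracket L (F j) (lie_scale L c x) = lie_add L (H (sc c h)) (lie_scale L c z)"
    using * scale by (simp add: bracket_scale_right F_closed nilp_closed H_scale scale_add H_closed)
  then show ?case using *(1) nilp.scale by blast
qed

text \<open>A bracket of \<open>n\<close> of the \<open>E i\<close> is an eigenvector of
  \<open>ad d\<close> with eigenvalue \<open>n\<close> times \<open>s\<close>, so every element of
  \<open>nilp\<close> is annihilated by a product of shifts by positive multiples of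
  \<open>s\<close>.\<close>

lemma nilp_killed:
  assumes d: "d \<in> lie_carrier L" "\<And>i. lie_bracket L d (E i) = lie_scale L s (E i)"
    and "x \<in> nilp"
  shows "\<exists>ks. set ks \<subseteq> range (\<lambda>n. of_nat (Suc n) * s) \<and> fold (lie_shift L d) ks x = lie_zero L"
  using assms(3)
proof (induction rule: nilp.induct)
  case (gen i)
  have "fold (lie_shift L d) [s] (E i) = lie_zero L"
    using d add_scale[OF E_closed[of i], of s "-s"]
    by (simp add: lie_shift_def scale_zero_left E_closed)
  moreover have "set [s] \<subseteq> range (\<lambda>n. of_nat (Suc n) * s)"
    by (auto intro!: range_eqI[of _ _ 0])
  ultimately show ?case by blast
next
  case (brack x i)
  then obtain ks where ks: "set ks \<subseteq> range (\<lambda>n. of_nat (Suc n) * s)"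
    "fold (lie_shift L d) ks x = lie_zero L" by blast
  \<comment> \<open>Bracketing with \<open>E i\<close> raises eigenvalues by \<open>s\<close>; hence
    it intertwines the shift by \<open>k\<close> with the shift by \<open>s + k\<close>.\<close>
  have sh: "lie_shift L d (s + k) (lie_bracket L (E i) y) = lie_bracket L (E i) (lie_shift L d k y)"
    if y: "y \<in> lie_carrier L" for k y
  proof -
    let ?b = "lie_bracket L (E i) y" and ?e = "lie_bracket L (E i) (lie_bracket L d y)"
    have c: "?b \<in> lie_carrier L" "?e \<in> lie_carrier L"
      using y d E_closed by (auto intro!: bracket_closed)
    have "lie_shift L d (s + k) ?b
        = lie_add L (lie_add L (lie_scale L s ?b) ?e) (lie_scale L (- (s + k)) ?b)"
      using y d E_closed[of i] by (simp add: lie_shift_def bracket_bracket[of d] bracket_scale_left)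
    also have "\<dots> = lie_add L ?e (lie_add L (lie_scale L s ?b) (lie_scale L (- (s + k)) ?b))"
      using c by (simp add: add_assoc add_left_commute scale_closed)
    also have "\<dots> = lie_add L ?e (lie_scale L (- k) ?b)"
      using c by (simp add: add_scale[symmetric])
    also have "\<dots> = lie_bracket L (E i) (lie_shift L d k y)"
      using y d E_closed[of i]
      by (simp add: lie_shift_def bracket_add_right bracket_scale_right bracket_closed scale_closed)
    finally show ?thesis .
  qed
  have "fold (lie_shift L d) (map ((+) s) ls) (lie_bracket L (E i) y)
      = lie_bracket L (E i) (fold (lie_shift L d) ls y)" if "y \<in> lie_carrier L" for ls y
    using that by (induction ls arbitrary: y) (simp_all add: sh lie_shift_closed d)
  then have "fold (lie_shift L d) (map ((+) s) ks) (lie_bracket L (E i) x) = lie_zero L"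
    using nilp_closed[OF brack(1)] ks(2) by (simp add: bracket_zero_right E_closed)
  moreover have step: "s + k \<in> range (\<lambda>n. of_nat (Suc n) * s)"
    if k: "k \<in> range (\<lambda>n. of_nat (Suc n) * s)" for k
  proof -
    obtain n where "k = of_nat (Suc n) * s" using k by blast
    then have "s + k = of_nat (Suc (Suc n)) * s" by (simp add: algebra_simps)
    then show ?thesis by (rule range_eqI)
  qed
  ultimately show ?case
    using subsetD[OF ks(1)] by (intro exI[of _ "map ((+) s) ks"]) (auto intro!: step simp del: of_nat_Suc)
next
  case zero
  show ?case by (rule exI[of _ "[]"]) simp
next
  case (add x y)
  then obtain ks ls where *: "set ks \<subseteq> range (\<lambda>n. of_nat (Suc n) * s)"
    "fold (lie_shift L d) ks x = lie_zero L" "set ls \<subseteq> range (\<lambda>n. of_nat (Suc n) * s)"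
    "fold (lie_shift L d) ls y = lie_zero L" by blast
  then show ?case
    using lie_shifts_kill_add[OF d(1) nilp_closed[OF add(1)] nilp_closed[OF add(2)] *(2,4)]
    by (intro exI[of _ "ks @ ls"]) simp
next
  case (scale x c)
  then obtain ks where *: "set ks \<subseteq> range (\<lambda>n. of_nat (Suc n) * s)"
    "fold (lie_shift L d) ks x = lie_zero L" by blast
  then show ?case
    using lie_shifts_scale[OF d(1) nilp_closed[OF scale(1)], of ks c]
    by (intro exI[of _ ks]) (simp add: scale_zero_right)
qed

end

text \<open>The defining relations together with generation, detached from the construction by terms
  and cosets.\<close>

locale kac_moody_generators = lie_algebra L
  for L :: "('k::field_char_0, 'a) lie_struct" +
  fixes sc :: "'k \<Rightarrow> 'h::ab_group_add \<Rightarrow> 'h"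
    and H :: "'h \<Rightarrow> 'a" and E F :: "'m::finite \<Rightarrow> 'a" and \<alpha> :: "'m \<Rightarrow> 'h \<Rightarrow> 'k" and \<alpha>v :: "'m \<Rightarrow> 'h"
  assumes H_closed: "H h \<in> lie_carrier L"
    and E_closed: "E i \<in> lie_carrier L"
    and F_closed: "F i \<in> lie_carrier L"
    and H_add: "H (h + h') = lie_add L (H h) (H h')"
    and H_scale: "H (sc c h) = lie_scale L c (H h)"
    and EF: "lie_bracket L (E i) (F j) = (if i = j then H (\<alpha>v i) else lie_zero L)"
    and HH: "lie_bracket L (H h) (H h') = lie_zero L"
    and HE: "lie_bracket L (H h) (E i) = lie_scale L (\<alpha> i h) (E i)"
    and HF: "lie_bracket L (H h) (F i) = lie_scale L (- \<alpha> i h) (F i)"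
    and generated: "lie_generated_by L (range H \<union> range E \<union> range F)"
begin

lemma EF_cartan: "\<exists>h. lie_bracket L (E i) (F j) = H h"
proof -
  have "H 0 = lie_zero L"
    using H_add[of 0 0] add_left_imp_eq[of "H 0" "H 0" "lie_zero L"] H_closed[of 0]
    by (simp add: add_zero zero_closed)
  then show ?thesis using EF by metis
qed

lemma FE_cartan: "\<exists>h. lie_bracket L (F j) (E i) = H h"
  using EF_cartan[of i j] bracket_anti[OF E_closed F_closed, of j i] H_scale by metis

sublocale upper: triangular_half L sc H E F \<alpha>
  by unfold_locales (use H_closed E_closed F_closed H_add H_scale HE FE_cartan in auto)

sublocale lower: triangular_half L sc H F E "\<lambda>i h. - \<alpha> i h"
  by unfold_locales (use H_closed E_closed F_closed H_add H_scale HF EF_cartan in auto)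

text \<open>The sum of the Cartan part and the two nilpotent halves; it is not claimed to be
  direct.\<close>

definition triangular :: "'a set" where
  "triangular = {x. \<exists>h. \<exists>y\<in>upper.nilp. \<exists>z\<in>lower.nilp. x = lie_add L (H h) (lie_add L y z)}"

lemma triangularI:
  "y \<in> upper.nilp \<Longrightarrow> z \<in> lower.nilp \<Longrightarrow> lie_add L (H h) (lie_add L y z) \<in> triangular"
  unfolding triangular_def by blast

lemma triangularE:
  assumes "x \<in> triangular"
  obtains h y z where "y \<in> upper.nilp" "z \<in> lower.nilp" "x = lie_add L (H h) (lie_add L y z)"
  using assms unfolding triangular_def by blast

lemma triangular_closed: "x \<in> triangular \<Longrightarrow> x \<in> lie_carrier L"
  by (elim triangularE) (simp add: add_closed H_closed upper.nilp_closed lower.nilp_closed)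

lemma H_triangular: "H h \<in> triangular"
  using triangularI[OF upper.nilp.zero lower.nilp.zero, of h] H_closed[of h]
  by (simp add: add_zero zero_closed)

lemma upper_triangular: "y \<in> upper.nilp \<Longrightarrow> y \<in> triangular"
  using triangularI[OF _ lower.nilp.zero, of y 0] upper.nilp_closed[of y]
  by (simp add: upper.H_zero add_zero zero_add)

lemma lower_triangular: "z \<in> lower.nilp \<Longrightarrow> z \<in> triangular"
  using triangularI[OF upper.nilp.zero, of z 0] lower.nilp_closed[of z]
  by (simp add: upper.H_zero zero_add)

lemma triangular_add: assumes "x \<in> triangular" "x' \<in> triangular" shows "lie_add L x x' \<in> triangular"
proof -
  obtain h y z h' y' z' where *: "y \<in> upper.nilp" "z \<in> lower.nilp" "x = lie_add L (H h) (lie_add L y z)"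
    "y' \<in> upper.nilp" "z' \<in> lower.nilp" "x' = lie_add L (H h') (lie_add L y' z')"
    using assms by (elim triangularE) blast
  have "lie_add L x x' = lie_add L (H (h + h')) (lie_add L (lie_add L y y') (lie_add L z z'))"
    using * upper.nilp_closed lower.nilp_closed H_closed
    by (simp add: H_add add_assoc add_closed add_left_commute)
  then show ?thesis using * by (simp add: triangularI upper.nilp.add lower.nilp.add)
qed

lemma triangular_scale: assumes "x \<in> triangular" shows "lie_scale L c x \<in> triangular"
proof -
  obtain h y z where *: "y \<in> upper.nilp" "z \<in> lower.nilp" "x = lie_add L (H h) (lie_add L y z)"
    using assms by (elim triangularE)
  have "lie_scale L c x = lie_add L (H (sc c h)) (lie_add L (lie_scale L c y) (lie_scale L c z))"
    using * upper.nilp_closed lower.nilp_closed H_closed by (simp add: H_scale scale_add add_closed)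
  then show ?thesis using * by (simp add: triangularI upper.nilp.scale lower.nilp.scale)
qed

text \<open>A Cartan element preserves each half. A root generator maps the Cartan part and its own
  half into its own half, and sends the opposite half into the Cartan part plus that half by
  \<open>bracket_F_nilp\<close>.\<close>

lemma bracket_generator_triangular:
  assumes g: "g \<in> range H \<union> range E \<union> range F" and "x \<in> triangular"
  shows "lie_bracket L g x \<in> triangular"
proof -
  obtain h y z where *: "y \<in> upper.nilp" "z \<in> lower.nilp" "x = lie_add L (H h) (lie_add L y z)"
    using assms by (elim triangularE)
  have gc: "g \<in> lie_carrier L" using g H_closed E_closed F_closed by auto
  have expand: "lie_bracket L g x
      = lie_add L (lie_bracket L g (H h)) (lie_add L (lie_bracket L g y) (lie_bracket L g z))"
    using * gc upper.nilp_closed lower.nilp_closed H_closed by (simp add: bracket_add_right add_closed)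
  have "lie_bracket L g (H h) \<in> triangular \<and> lie_bracket L g y \<in> triangular \<and> lie_bracket L g z \<in> triangular"
  proof -
    consider h' where "g = H h'" | i where "g = E i" | i where "g = F i" using g by blast
    then show ?thesis
    proof cases
      case 1
      then show ?thesis
        using *(1,2) HH[of h' h] upper_triangular[OF upper.nilp.zero]
        by (simp add: upper_triangular upper.bracket_H_nilp lower_triangular lower.bracket_H_nilp)
    next
      case 2
      have "lie_bracket L (E i) (H h) = lie_scale L (- \<alpha> i h) (E i)"
        using bracket_anti[OF H_closed E_closed, of i h] by (simp add: HE scale_scale E_closed)
      then have "lie_bracket L g (H h) \<in> triangular"
        using 2 by (simp add: upper_triangular upper.nilp.intros)
      moreover have "lie_bracket L g y \<in> triangular"
        using 2 *(1) by (simp add: upper_triangular upper.nilp.intros)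
      moreover have "lie_bracket L g z \<in> triangular"
        using 2 lower.bracket_F_nilp[OF *(2), of i] by (auto simp: triangular_add H_triangular lower_triangular)
      ultimately show ?thesis by blast
    next
      case 3
      have "lie_bracket L (F i) (H h) = lie_scale L (\<alpha> i h) (F i)"
        using bracket_anti[OF H_closed F_closed, of i h] by (simp add: HF scale_scale F_closed)
      then have "lie_bracket L g (H h) \<in> triangular"
        using 3 by (simp add: lower_triangular lower.nilp.intros)
      moreover have "lie_bracket L g z \<in> triangular"
        using 3 *(2) by (simp add: lower_triangular lower.nilp.intros)
      moreover have "lie_bracket L g y \<in> triangular"
        using 3 upper.bracket_F_nilp[OF *(1), of i] by (auto simp: triangular_add H_triangular upper_triangular)
      ultimately show ?thesis by blast
    qed
  qed
  then show ?thesis unfolding expand by (intro triangular_add) auto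
qed

text \<open>The elements whose bracket preserves \<open>triangular\<close> form a subalgebra by the
  Jacobi identity, and it contains the generators, so it is everything. Therefore
  \<open>triangular\<close> is itself a subalgebra containing the generators.\<close>

lemma triangular_decomposition: assumes "x \<in> lie_carrier L" shows "x \<in> triangular"
proof -
  let ?G = "range H \<union> range E \<union> range F"
  let ?T = "{g \<in> lie_carrier L. \<forall>x\<in>triangular. lie_bracket L g x \<in> triangular}"
  have zero: "lie_zero L \<in> triangular" by (rule upper_triangular[OF upper.nilp.zero])
  have "lie_bracket L (lie_bracket L a b) x \<in> triangular"
    if "a \<in> ?T" "b \<in> ?T" "x \<in> triangular" for a b x
  proof -
    have c: "a \<in> lie_carrier L" "b \<in> lie_carrier L" "x \<in> lie_carrier L"
      using that triangular_closed by auto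
    let ?u = "lie_bracket L b (lie_bracket L a x)"
    have "lie_add L (lie_bracket L a (lie_bracket L b x)) (lie_scale L (-1) ?u)
      = lie_bracket L (lie_bracket L a b) x"
      using c by (simp add: bracket_bracket[OF c] add_assoc add_neg add_zero bracket_closed scale_closed)
    moreover have "lie_bracket L a (lie_bracket L b x) \<in> triangular" "?u \<in> triangular"
      using that by auto
    ultimately show ?thesis by (metis triangular_add triangular_scale)
  qed
  then have "lie_subalgebra L ?T"
    by (auto simp: lie_subalgebra_def zero_closed add_closed scale_closed bracket_closed zero
        bracket_zero_left bracket_add_left bracket_scale_left triangular_closed
        intro!: triangular_add triangular_scale)
  moreover have "?G \<subseteq> ?T"
    using bracket_generator_triangular H_closed E_closed F_closed by auto
  ultimately have T: "lie_carrier L \<subseteq> ?T" using generated unfolding lie_generated_by_def by blast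
  have "lie_bracket L a b \<in> triangular" if "a \<in> triangular" "b \<in> triangular" for a b
    using subsetD[OF T triangular_closed[OF that(1)]] that(2) by simp
  then have "lie_subalgebra L triangular"
    by (simp add: lie_subalgebra_def zero triangular_add triangular_scale triangular_closed subset_eq)
  moreover have "?G \<subseteq> triangular"
    using H_triangular upper_triangular[OF upper.nilp.gen] lower_triangular[OF lower.nilp.gen] by blast
  ultimately show ?thesis using generated assms unfolding lie_generated_by_def by blast
qed

section \<open>The radical\<close>

text \<open>The element \<open>h0\<close> defines the principal grading: a bracket of
  \<open>n\<close> of the \<open>E i\<close> has eigenvalue \<open>n\<close> under
  \<open>ad (H h0)\<close>, and a bracket of \<open>n\<close> of the \<open>F i\<close> has
  eigenvalue \<open>-n\<close>.\<close>

context
  fixes h0 :: 'h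
  assumes h0: "\<And>i. \<alpha> i h0 = 1"
begin

text \<open>The ad-semisimple element \<open>H h0\<close> acts by nonzero scalars on the root vectors outside the
  Cartan subalgebra, so \<open>off_cartan\<close> is the sum of the nonzero weight spaces.\<close>

definition off_cartan :: "'a set" where
  "off_cartan = {x \<in> lie_carrier L. \<exists>ks. 0 \<notin> set ks \<and> fold (lie_shift L (H h0)) ks x = lie_zero L}"

lemma off_cartan_add:
  assumes "x \<in> off_cartan" "y \<in> off_cartan" shows "lie_add L x y \<in> off_cartan"
proof -
  obtain ks ls where *: "x \<in> lie_carrier L" "0 \<notin> set ks" "fold (lie_shift L (H h0)) ks x = lie_zero L"
    "y \<in> lie_carrier L" "0 \<notin> set ls" "fold (lie_shift L (H h0)) ls y = lie_zero L"
    using assms unfolding off_cartan_def by blast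
  then show ?thesis
    unfolding off_cartan_def using lie_shifts_kill_add[OF H_closed[of h0] *(1,4,3,6)]
    by (auto intro!: add_closed exI[of _ "ks @ ls"] simp del: fold_append)
qed

lemma upper_off_cartan: assumes "x \<in> upper.nilp" shows "x \<in> off_cartan"
proof -
  obtain ks where ks: "set ks \<subseteq> range (\<lambda>n. of_nat (Suc n) * 1)" "fold (lie_shift L (H h0)) ks x = lie_zero L"
    using upper.nilp_killed[OF H_closed[of h0] _ assms, of 1] HE h0 by auto
  have "0 \<notin> range (\<lambda>n. of_nat (Suc n) * (1 :: 'k))" by (auto simp del: of_nat_Suc)
  then show ?thesis using ks upper.nilp_closed[OF assms] unfolding off_cartan_def by blast
qed

lemma lower_off_cartan: assumes "x \<in> lower.nilp" shows "x \<in> off_cartan"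
proof -
  obtain ks where ks: "set ks \<subseteq> range (\<lambda>n. of_nat (Suc n) * - 1)" "fold (lie_shift L (H h0)) ks x = lie_zero L"
    using lower.nilp_killed[OF H_closed[of h0] _ assms, of "-1"] HF h0 by auto
  have "0 \<notin> range (\<lambda>n. of_nat (Suc n) * (- 1 :: 'k))" by (auto simp del: of_nat_Suc)
  then show ?thesis using ks lower.nilp_closed[OF assms] unfolding off_cartan_def by blast
qed

lemma prod_list_uminus_nonzero: "0 \<notin> set ks \<Longrightarrow> (\<Prod>k\<leftarrow>ks. - k) \<noteq> (0 :: 'k)"
  by (induction ks) auto

text \<open>The Cartan part is killed by \<open>ad (H h0)\<close>, so shifts by nonzero scalars act
  on it as a nonzero scalar and cannot annihilate a nonzero element.\<close>

lemma H_off_cartan: assumes "H h \<in> off_cartan" shows "H h = lie_zero L"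
proof -
  obtain ks where "0 \<notin> set ks" "fold (lie_shift L (H h0)) ks (H h) = lie_zero L"
    using assms unfolding off_cartan_def by blast
  then show ?thesis
    using lie_shifts_kernel[OF H_closed[of h0] H_closed[of h] HH, of ks] prod_list_uminus_nonzero[of ks]
      scale_mem_cancel[of "{lie_zero L}" "H h" "\<Prod>k\<leftarrow>ks. - k"] H_closed scale_zero_right
    by auto
qed

text \<open>An ideal is stable under the shifts. Those annihilating the off-Cartan part of
  \<open>x\<close> leave a nonzero multiple of its Cartan part in the ideal, and an ideal meeting
  the Cartan subalgebra trivially forces that part to vanish.\<close>

lemma ideal_off_cartan:
  assumes I: "I \<in> trivially_intersecting_ideals L (range H)" and x: "x \<in> I"
  shows "x \<in> off_cartan"
proof -
  have I': "lie_ideal L I" "I \<inter> range H = {lie_zero L}"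
    using I by (auto simp: trivially_intersecting_ideals_def)
  note sub = I'(1)[unfolded lie_ideal_def]
  obtain h y z where yz: "y \<in> upper.nilp" "z \<in> lower.nilp" "x = lie_add L (H h) (lie_add L y z)"
    using triangular_decomposition sub x by (meson subsetD triangularE)
  let ?w = "lie_add L y z"
  have w: "?w \<in> off_cartan" using yz by (simp add: off_cartan_add upper_off_cartan lower_off_cartan)
  then obtain ks where ks: "?w \<in> lie_carrier L" "0 \<notin> set ks" "fold (lie_shift L (H h0)) ks ?w = lie_zero L"
    unfolding off_cartan_def by blast
  have "fold (lie_shift L (H h0)) ls v \<in> I" if "v \<in> I" for ls v
    using that sub H_closed by (induction ls arbitrary: v) (simp_all add: lie_shift_def)
  then have "fold (lie_shift L (H h0)) ks x \<in> I" using x by blast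
  also have "fold (lie_shift L (H h0)) ks x = lie_scale L (\<Prod>k\<leftarrow>ks. - k) (H h)"
    using yz(3) ks H_closed lie_shifts_kernel[OF H_closed[of h0] H_closed[of h] HH, of ks]
    by (simp add: lie_shifts_add add_zero scale_closed)
  finally have "H h \<in> I"
    using scale_mem_cancel[OF _ H_closed prod_list_uminus_nonzero[OF ks(2)], of I h] sub by blast
  then have "H h = lie_zero L" using I'(2) by blast
  then show ?thesis using w yz(3) ks(1) by (simp add: zero_add)
qed

text \<open>The sum of the two ideals stays inside \<open>off_cartan\<close>, which meets the Cartan
  subalgebra only in zero. This makes the family of such ideals directed.\<close>

lemma trivially_intersecting_sum:
  assumes I: "I \<in> trivially_intersecting_ideals L (range H)"
    and J: "J \<in> trivially_intersecting_ideals L (range H)"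
  obtains K where "K \<in> trivially_intersecting_ideals L (range H)" "I \<subseteq> K" "J \<subseteq> K"
proof -
  define K where "K = {lie_add L x y | x y. x \<in> I \<and> y \<in> J}"
  have IJ: "lie_ideal L I" "lie_ideal L J" using I J by (auto simp: trivially_intersecting_ideals_def)
  have c: "x \<in> lie_carrier L" if "x \<in> I \<or> x \<in> J" for x using that IJ by (auto simp: lie_ideal_def)
  have KI: "lie_add L x y \<in> K" if "x \<in> I" "y \<in> J" for x y using that unfolding K_def by blast
  have z: "lie_zero L \<in> I" "lie_zero L \<in> J" using IJ by (auto simp: lie_ideal_def)
  have IK: "I \<subseteq> K" using KI[OF _ z(2)] c by (auto simp: add_zero)
  have JK: "J \<subseteq> K" using KI[OF z(1)] c by (auto simp: zero_add)
  have "lie_ideal L K"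
    unfolding lie_ideal_def
  proof (intro conjI ballI allI)
    show "K \<subseteq> lie_carrier L" using c by (auto simp: K_def intro: add_closed)
    show "lie_zero L \<in> K" using KI[OF z] by (simp add: add_zero zero_closed)
  next
    fix u v assume "u \<in> K" "v \<in> K"
    then obtain x y x' y' where *: "x \<in> I" "y \<in> J" "u = lie_add L x y" "x' \<in> I" "y' \<in> J" "v = lie_add L x' y'"
      unfolding K_def by blast
    have "lie_add L u v = lie_add L (lie_add L x x') (lie_add L y y')"
      using * c by (simp add: add_assoc add_closed add_left_commute)
    then show "lie_add L u v \<in> K" using * IJ KI by (simp add: lie_ideal_def)
  next
    fix k u assume "u \<in> K"
    then obtain x y where *: "x \<in> I" "y \<in> J" "u = lie_add L x y" unfolding K_def by blast
    have "lie_scale L k u = lie_add L (lie_scale L k x) (lie_scale L k y)" using * c by (simp add: scale_add)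
    then show "lie_scale L k u \<in> K" using * IJ KI by (simp add: lie_ideal_def)
  next
    fix k u assume k: "k \<in> lie_carrier L" and "u \<in> K"
    then obtain x y where *: "x \<in> I" "y \<in> J" "u = lie_add L x y" unfolding K_def by blast
    have "lie_bracket L k u = lie_add L (lie_bracket L k x) (lie_bracket L k y)"
      using * c k by (simp add: bracket_add_right)
    then show "lie_bracket L k u \<in> K" using * IJ KI k by (simp add: lie_ideal_def)
  qed
  moreover have "K \<inter> range H = {lie_zero L}"
  proof -
    have zero: "u = lie_zero L" if u: "u \<in> K" "u \<in> range H" for u
    proof -
      obtain x y where *: "x \<in> I" "y \<in> J" "u = lie_add L x y" using u(1) unfolding K_def by blast
      obtain h where h: "u = H h" using u(2) by blast
      have "H h \<in> off_cartan"
        unfolding h[symmetric] *(3)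
        using off_cartan_add[OF ideal_off_cartan[OF I *(1)] ideal_off_cartan[OF J *(2)]] .
      then show ?thesis unfolding h by (rule H_off_cartan)
    qed
    have "lie_zero L \<in> K \<inter> range H"
      using KI[OF z] upper.H_zero rangeI[of H 0] by (simp add: add_zero zero_closed)
    moreover have "K \<inter> range H \<subseteq> {lie_zero L}"
    proof
      fix u assume "u \<in> K \<inter> range H"
      then show "u \<in> {lie_zero L}" using zero[of u] by (elim IntE) simp
    qed
    ultimately show ?thesis by (simp add: subset_antisym)
  qed
  ultimately have "K \<in> trivially_intersecting_ideals L (range H)"
    by (simp add: trivially_intersecting_ideals_def)
  then show thesis using IK JK by (rule that)
qed

text \<open>Because the family is directed, its union is an ideal. The union still meets the Cartan
  subalgebra trivially and contains every member, so it is the unique maximal one that the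
  description operator selects.\<close>

lemma lie_ideal_maximal_trivially_intersecting:
  "lie_ideal L (THE I. I \<in> trivially_intersecting_ideals L (range H) \<and>
      (\<forall>J\<in>trivially_intersecting_ideals L (range H). I \<subseteq> J \<longrightarrow> J = I))"
proof -
  let ?TI = "trivially_intersecting_ideals L (range H)"
  define R where "R = \<Union>?TI"
  have id: "lie_ideal L I" "I \<inter> range H = {lie_zero L}" if "I \<in> ?TI" for I
    using that by (auto simp: trivially_intersecting_ideals_def)
  have zero: "{lie_zero L} \<in> ?TI"
    using upper.H_zero rangeI[of H 0]
    by (auto simp: trivially_intersecting_ideals_def lie_ideal_def zero_closed add_zero
        scale_zero_right bracket_zero_right)
  have "lie_ideal L R"
    unfolding lie_ideal_def
  proof (intro conjI ballI allI)
    show "R \<subseteq> lie_carrier L" using id(1) unfolding R_def lie_ideal_def by blast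
    show "lie_zero L \<in> R" using zero unfolding R_def by blast
  next
    fix a b assume "a \<in> R" "b \<in> R"
    then obtain I J where IJ: "I \<in> ?TI" "a \<in> I" "J \<in> ?TI" "b \<in> J" unfolding R_def by blast
    obtain K where K: "K \<in> ?TI" "I \<subseteq> K" "J \<subseteq> K" by (rule trivially_intersecting_sum[OF IJ(1,3)])
    have "lie_add L a b \<in> K"
      using id(1)[OF K(1)] subsetD[OF K(2) IJ(2)] subsetD[OF K(3) IJ(4)] unfolding lie_ideal_def by blast
    then show "lie_add L a b \<in> R" using K(1) unfolding R_def by (rule UnionI[rotated])
  next
    fix c a assume "a \<in> R"
    then show "lie_scale L c a \<in> R" using id(1) unfolding R_def lie_ideal_def by blast
  next
    fix x a assume "x \<in> lie_carrier L" "a \<in> R"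
    then show "lie_bracket L x a \<in> R" using id(1) unfolding R_def lie_ideal_def by blast
  qed
  moreover have "R \<inter> range H = {lie_zero L}"
  proof (intro subset_antisym subsetI)
    fix x assume x: "x \<in> R \<inter> range H"
    then obtain I where I: "I \<in> ?TI" "x \<in> I" unfolding R_def by (elim IntE UnionE)
    then have "x \<in> I \<inter> range H" using x by (intro IntI) simp_all
    then show "x \<in> {lie_zero L}" unfolding id(2)[OF I(1)] .
  next
    fix x assume "x \<in> {lie_zero L}"
    then have "x = H 0" by (simp add: upper.H_zero)
    then show "x \<in> R \<inter> range H" using zero unfolding R_def by (auto simp: upper.H_zero[symmetric])
  qed
  ultimately have R: "R \<in> ?TI" by (simp add: trivially_intersecting_ideals_def)
  have max: "I \<subseteq> R" if "I \<in> ?TI" for I using that unfolding R_def by blast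
  have "(THE I. I \<in> ?TI \<and> (\<forall>J\<in>?TI. I \<subseteq> J \<longrightarrow> J = I)) = R"
    by (rule the_equality) (use R max in blast)+
  then show ?thesis using id(1)[OF R] by simp
qed

end

section \<open>Few generators\<close>

text \<open>Brackets with \<open>H (u 0)\<close> separate the summands of \<open>H (u 1) + \<Sum>\<^sub>i E i + \<Sum>\<^sub>i F i\<close>, which have
  the distinct eigenvalues \<open>0\<close> and \<open>\<plusminus> \<alpha> i (u 0)\<close>.\<close>

lemma generated_by_few:
  fixes u :: "nat \<Rightarrow> 'h"
  assumes vs: "vector_space sc" and p: "2 \<le> p"
    and span: "module.span sc (range \<alpha>v \<union> u ` {..<p}) = UNIV"
    and nz: "\<And>i. \<alpha> i (u 0) \<noteq> 0" and inj: "inj (\<lambda>i. \<alpha> i (u 0))"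
    and opp: "\<And>i j. \<alpha> i (u 0) \<noteq> - \<alpha> j (u 0)"
  obtains y where "lie_generated_by L (y ` {..<p :: nat})"
proof -
  note scale_zero = scale_zero_left[OF H_closed]
  interpret vector_space sc by fact
  obtain xs :: "('m + 'm) option list" where xs: "set xs = UNIV" "distinct xs"
    using finite_distinct_list[of "UNIV :: ('m + 'm) option set"] by auto
  define v where "v = (\<lambda>t. case t of None \<Rightarrow> H (u 1) | Some (Inl i) \<Rightarrow> E i | Some (Inr i) \<Rightarrow> F i)"
  define \<mu> where "\<mu> = (\<lambda>t. case t of None \<Rightarrow> 0 | Some (Inl i) \<Rightarrow> \<alpha> i (u 0) | Some (Inr i) \<Rightarrow> - \<alpha> i (u 0))"
  \<comment> \<open>\<open>y 0\<close> is the regular element and \<open>y 1\<close> packs all root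
    generators into one sum, with \<open>H (u 1)\<close> riding along as the summand of eigenvalue
    0. The condition \<open>2 \<le> p\<close> makes both available.\<close>
  define y where "y k = (if k = 1 then lie_sum L v xs else H (u k))" for k :: nat
  have v: "v t \<in> lie_carrier L" for t
    by (auto simp: v_def H_closed E_closed F_closed split: option.split sum.split)
  have ev: "lie_bracket L (H (u 0)) (v t) = lie_scale L (\<mu> t) (v t)" for t
    by (auto simp: v_def \<mu>_def HH HE HF scale_zero split: option.split sum.split)
  \<comment> \<open>\<open>nz\<close> separates 0 from the root values, \<open>inj\<close> separates
    values of equal sign, and \<open>opp\<close> separates an \<open>E\<close> from an
    \<open>F\<close>.\<close>
  have "\<mu> s = \<mu> t \<Longrightarrow> s = t" for s t
    using nz inj opp opp[symmetric]
    by (auto simp: \<mu>_def inj_eq neg_equal_0_iff_equal dest: injD split: option.splits sum.splits)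
  then have inj_\<mu>: "inj_on \<mu> (set xs)" by (auto simp: inj_on_def)
  have "lie_generated_by L (y ` {..<p})"
    unfolding lie_generated_by_def
  proof (intro conjI allI impI)
    show "y ` {..<p} \<subseteq> lie_carrier L" by (auto simp: y_def H_closed lie_sum_closed v)
    fix S assume S: "lie_subalgebra L S" "y ` {..<p} \<subseteq> S"
    note S' = S(1)[unfolded lie_subalgebra_def]
    have yS: "y k \<in> S" if "k < p" for k using S(2) that by blast
    have H0: "H (u 0) \<in> S" and sum: "lie_sum L v xs \<in> S"
      using yS[of 0] yS[of 1] p by (simp_all add: y_def)
    have vS: "v t \<in> S" for t
      using eigenvectors_mem_lie_subalgebra[OF S(1) H0 xs(2) inj_\<mu> v ev sum] xs(1) by blast
    have ES: "E i \<in> S" and FS: "F i \<in> S" for i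
      using vS[of "Some (Inl i)"] vS[of "Some (Inr i)"] by (simp_all add: v_def)
    have HS: "H (u k) \<in> S" if "k < p" for k
      using yS[OF that] vS[of None] by (cases "k = 1") (simp_all add: y_def v_def)
    have "H (\<alpha>v i) \<in> S" for i
      using ES[of i] FS[of i] S' EF[of i i] by metis
    \<comment> \<open>Preimages of subspaces are subspaces, so it is enough to have the coroots,
      obtained as brackets of \<open>E i\<close> and \<open>F i\<close>, and the
      \<open>u k\<close>.\<close>
    moreover have "subspace {h. H h \<in> S}"
      using S' by (auto simp: subspace_def upper.H_zero H_add H_scale)
    ultimately have "span (range \<alpha>v \<union> u ` {..<p}) \<subseteq> {h. H h \<in> S}"
      using HS by (intro span_minimal) auto
    then have "range H \<subseteq> S" using span by auto
    then show "lie_carrier L \<subseteq> S"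
      using generated S(1) ES FS unfolding lie_generated_by_def by blast
  qed
  then show thesis by (rule that)
qed

end

section \<open>The presentation of the Kac-Moody algebra\<close>

lemma linear_relators_closed:
  "linear_relators sc \<subseteq> lie_carrier (free_lie UNIV :: ('k::field, ('k, 'v::ab_group_add) lie_term set) lie_struct)"
proof -
  interpret F: lie_algebra "free_lie UNIV :: ('k, ('k, 'v) lie_term set) lie_struct"
    by (rule lie_algebra_free_lie)
  show ?thesis
    by (auto simp: linear_relators_def Let_def lie_minus_def free_lie_gen_closed
        intro!: F.add_closed F.scale_closed)
qed

lemma lie_ideal_linear_relations: "lie_ideal (free_lie UNIV) (linear_relations_ideal sc)"
  unfolding linear_relations_ideal_def
  by (intro lie_algebra.lie_ideal_lie_ideal_generated lie_algebra_free_lie linear_relators_closed)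

lemma lie_algebra_free_lie_space: "lie_algebra (free_lie_space sc)"
  unfolding free_lie_space_def
  by (intro lie_algebra.lie_algebra_lie_quotient lie_algebra_free_lie lie_ideal_linear_relations)

lemma lie_ideal_generated_superset: "S \<subseteq> lie_ideal_generated L S"
  unfolding lie_ideal_generated_def by blast

lemma free_lie_space_incl_closed: "free_lie_space_incl sc v \<in> lie_carrier (free_lie_space sc)"
  by (simp add: free_lie_space_def free_lie_space_incl_def free_lie_gen_closed
      lie_algebra.lie_quotient_carrier[OF lie_algebra_free_lie])

lemma free_lie_space_incl_add:
  "free_lie_space_incl sc (u + v)
    = lie_add (free_lie_space sc) (free_lie_space_incl sc u) (free_lie_space_incl sc v)"
  and free_lie_space_incl_scale:
  "free_lie_space_incl sc (sc c v) = lie_scale (free_lie_space sc) c (free_lie_space_incl sc v)"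
proof -
  let ?F = "free_lie UNIV :: ('a, ('a, 'b) lie_term set) lie_struct"
  interpret F: lie_algebra ?F by (rule lie_algebra_free_lie)
  note I = lie_ideal_linear_relations[of sc]
  note hom = F.lie_hom_lie_coset[OF I]
  have g: "free_lie_gen UNIV x \<in> lie_carrier ?F" for x by (simp add: free_lie_gen_closed)
  have rel: "r \<in> linear_relations_ideal sc" if "r \<in> linear_relators sc" for r
    unfolding linear_relations_ideal_def using subsetD[OF lie_ideal_generated_superset that] .
  have "lie_coset ?F (linear_relations_ideal sc) (free_lie_gen UNIV (u + v))
    = lie_coset ?F (linear_relations_ideal sc) (lie_add ?F (free_lie_gen UNIV u) (free_lie_gen UNIV v))"
    by (rule F.lie_coset_eqI[OF I g F.add_closed[OF g g] rel]) (auto simp: linear_relators_def Let_def)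
  then show "free_lie_space_incl sc (u + v)
    = lie_add (free_lie_space sc) (free_lie_space_incl sc u) (free_lie_space_incl sc v)"
    by (simp add: free_lie_space_incl_def free_lie_space_def lie_hom_add[OF hom g g])
  have "lie_coset ?F (linear_relations_ideal sc) (free_lie_gen UNIV (sc c v))
    = lie_coset ?F (linear_relations_ideal sc) (lie_scale ?F c (free_lie_gen UNIV v))"
    by (rule F.lie_coset_eqI[OF I g F.scale_closed[OF g] rel]) (auto simp: linear_relators_def Let_def)
  then show "free_lie_space_incl sc (sc c v) = lie_scale (free_lie_space sc) c (free_lie_space_incl sc v)"
    by (simp add: free_lie_space_incl_def free_lie_space_def lie_hom_scale[OF hom g])
qed

lemma lie_generated_by_free_lie_space:
  "lie_generated_by (free_lie_space sc) (range (free_lie_space_incl sc))"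
proof -
  interpret F: lie_algebra "free_lie UNIV :: ('a, ('a, 'b) lie_term set) lie_struct"
    by (rule lie_algebra_free_lie)
  have "lie_generated_by (free_lie_space sc)
      (lie_coset (free_lie UNIV) (linear_relations_ideal sc) ` (free_lie_gen UNIV ` UNIV))"
    by (rule F.lie_generated_by_image[OF lie_algebra_free_lie_space _ _ lie_generated_by_free_lie])
      (simp_all add: free_lie_space_def F.lie_hom_lie_coset lie_ideal_linear_relations F.lie_quotient_carrier)
  then show ?thesis by (simp add: image_image free_lie_space_incl_def[abs_def])
qed

text \<open>The canonical map from the generating space to the algebra presented by the relations;
  on the three kinds of basic triples it gives the Cartan elements, the \<open>e\<^sub>i\<close> and
  the \<open>f\<^sub>i\<close>.\<close>

definition km_incl :: "('k::field \<Rightarrow> 'h::ab_group_add \<Rightarrow> 'h) \<Rightarrow> ('m::finite \<Rightarrow> 'h \<Rightarrow> 'k)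
    \<Rightarrow> ('m \<Rightarrow> 'h) \<Rightarrow> 'h \<times> ('k^'m) \<times> ('k^'m) \<Rightarrow> ('k, 'h, 'm) km_free set" where
  "km_incl sc \<alpha> \<alpha>v v = lie_coset (free_lie_space (km_scale sc)) (km_relations_ideal sc \<alpha> \<alpha>v)
      (free_lie_space_incl (km_scale sc) v)"

text \<open>The relations hold because each relator lies in the ideal. For generation, the whole
  generating space generates, and its vectors are linear combinations of Cartan elements and the
  basis vectors \<open>axis i 1\<close>.\<close>

lemma kac_moody_generators_km_tilde:
  fixes sc :: "'k::field_char_0 \<Rightarrow> 'h::ab_group_add \<Rightarrow> 'h"
    and \<alpha> :: "'m::finite \<Rightarrow> 'h \<Rightarrow> 'k"
  assumes vs: "vector_space sc"
  shows "kac_moody_generators (km_tilde sc \<alpha> \<alpha>v) sc (\<lambda>h. km_incl sc \<alpha> \<alpha>v (h, 0, 0))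
    (\<lambda>i. km_incl sc \<alpha> \<alpha>v (0, axis i 1, 0)) (\<lambda>i. km_incl sc \<alpha> \<alpha>v (0, 0, axis i 1)) \<alpha> \<alpha>v"
proof -
  let ?F = "free_lie_space (km_scale sc) :: ('k, ('k, 'h, 'm) km_free) lie_struct"
  let ?\<iota> = "free_lie_space_incl (km_scale sc) :: 'h \<times> ('k^'m) \<times> ('k^'m) \<Rightarrow> ('k, 'h, 'm) km_free"
  let ?J = "km_relations_ideal sc \<alpha> \<alpha>v"
  let ?T = "km_tilde sc \<alpha> \<alpha>v"
  let ?k = "km_incl sc \<alpha> \<alpha>v"
  interpret vector_space sc by fact
  interpret F: lie_algebra ?F by (rule lie_algebra_free_lie_space)
  note \<iota> = free_lie_space_incl_closed[of "km_scale sc"]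
  note ops = F.zero_closed F.add_closed F.scale_closed F.bracket_closed
  have rel_closed: "km_relators sc \<alpha> \<alpha>v \<subseteq> lie_carrier ?F"
    by (auto simp: km_relators_def Let_def lie_minus_def \<iota> intro!: ops)
  have J: "lie_ideal ?F ?J"
    unfolding km_relations_ideal_def by (rule F.lie_ideal_lie_ideal_generated[OF rel_closed])
  have rel: "r \<in> ?J" if "r \<in> km_relators sc \<alpha> \<alpha>v" for r
    unfolding km_relations_ideal_def using subsetD[OF lie_ideal_generated_superset that] .
  interpret T: lie_algebra ?T
    unfolding km_tilde_def by (rule F.lie_algebra_lie_quotient[OF J])
  let ?\<pi> = "lie_coset ?F ?J"
  have \<pi>: "lie_hom ?F ?T ?\<pi>" "?\<pi> ` lie_carrier ?F = lie_carrier ?T" "?\<pi> (lie_zero ?F) = lie_zero ?T"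
    using F.lie_hom_lie_coset[OF J] F.lie_quotient_carrier[of ?J]
    by (simp_all add: km_tilde_def lie_quotient_def)
  have k: "?k v = ?\<pi> (?\<iota> v)" for v by (simp add: km_incl_def)
  have k_closed: "?k v \<in> lie_carrier ?T" for v
    unfolding k by (rule lie_hom_closed[OF \<pi>(1) \<iota>])
  have k_add: "?k (u + v) = lie_add ?T (?k u) (?k v)" for u v
    unfolding k free_lie_space_incl_add by (rule lie_hom_add[OF \<pi>(1) \<iota> \<iota>])
  have k_scale: "?k (km_scale sc c v) = lie_scale ?T c (?k v)" for c v
    unfolding k free_lie_space_incl_scale by (rule lie_hom_scale[OF \<pi>(1) \<iota>])
  have k_bracket: "lie_bracket ?T (?k u) (?k v) = ?\<pi> (lie_bracket ?F (?\<iota> u) (?\<iota> v))" for u v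
    unfolding k by (rule lie_hom_bracket[OF \<pi>(1) \<iota> \<iota>, symmetric])
  have minus: "?\<pi> x = ?\<pi> y"
    if "lie_minus ?F x y \<in> km_relators sc \<alpha> \<alpha>v" "x \<in> lie_carrier ?F" "y \<in> lie_carrier ?F" for x y
    using F.lie_coset_eqI[OF J that(2,3) rel[OF that(1)]] .
  have EF: "lie_bracket ?T (?k (0, axis i 1, 0)) (?k (0, 0, axis j 1))
      = (if i = j then ?k (\<alpha>v i, 0, 0) else lie_zero ?T)" for i j
  proof -
    have "?\<pi> (lie_bracket ?F (?\<iota> (0, axis i 1, 0)) (?\<iota> (0, 0, axis j 1)))
        = ?\<pi> (if i = j then ?\<iota> (\<alpha>v i, 0, 0) else lie_zero ?F)"
      by (rule minus) (auto simp: km_relators_def Let_def \<iota> intro: ops)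
    then show ?thesis unfolding k_bracket by (simp add: k \<pi>(3))
  qed
  have HH: "lie_bracket ?T (?k (h, 0, 0)) (?k (h', 0, 0)) = lie_zero ?T" for h h'
  proof -
    have "?\<pi> (lie_bracket ?F (?\<iota> (h, 0, 0)) (?\<iota> (h', 0, 0))) = lie_zero (lie_quotient ?F ?J)"
      by (intro F.lie_coset_zeroI[OF J] rel) (auto simp: km_relators_def Let_def)
    then show ?thesis unfolding k_bracket by (simp add: km_tilde_def)
  qed
  have HE: "lie_bracket ?T (?k (h, 0, 0)) (?k (0, axis i 1, 0)) = lie_scale ?T (\<alpha> i h) (?k (0, axis i 1, 0))" for h i
  proof -
    have "?\<pi> (lie_bracket ?F (?\<iota> (h, 0, 0)) (?\<iota> (0, axis i 1, 0)))
        = ?\<pi> (lie_scale ?F (\<alpha> i h) (?\<iota> (0, axis i 1, 0)))"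
      by (rule minus) (auto simp: km_relators_def Let_def \<iota> intro: ops)
    then show ?thesis unfolding k_bracket by (simp add: k lie_hom_scale[OF \<pi>(1) \<iota>])
  qed
  have HF: "lie_bracket ?T (?k (h, 0, 0)) (?k (0, 0, axis i 1)) = lie_scale ?T (- \<alpha> i h) (?k (0, 0, axis i 1))" for h i
  proof -
    have "?\<pi> (lie_bracket ?F (?\<iota> (h, 0, 0)) (?\<iota> (0, 0, axis i 1)))
        = ?\<pi> (lie_scale ?F (- \<alpha> i h) (?\<iota> (0, 0, axis i 1)))"
      by (rule minus) (auto simp: km_relators_def Let_def \<iota> intro: ops)
    then show ?thesis unfolding k_bracket by (simp add: k lie_hom_scale[OF \<pi>(1) \<iota>])
  qed
  let ?G = "range (\<lambda>h. ?k (h, 0, 0)) \<union> range (\<lambda>i. ?k (0, axis i 1, 0)) \<union> range (\<lambda>i. ?k (0, 0, axis i 1))"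
  have "lie_generated_by ?T (?\<pi> ` range ?\<iota>)"
    by (rule F.lie_generated_by_image[OF T.lie_algebra_axioms \<pi>(1,2) lie_generated_by_free_lie_space])
  then have gen_k: "lie_generated_by ?T (range ?k)" by (simp add: image_image k)
  have generated: "lie_generated_by ?T ?G"
    unfolding lie_generated_by_def
  proof (intro conjI allI impI)
    show "?G \<subseteq> lie_carrier ?T" using k_closed by auto
    fix S assume S: "lie_subalgebra ?T S" "?G \<subseteq> S"
    note S' = S(1)[unfolded lie_subalgebra_def]
    have kH: "?k (h, 0, 0) \<in> S" and kE: "?k (0, axis i 1, 0) \<in> S" and kF: "?k (0, 0, axis i 1) \<in> S" for h i
      using S(2) by auto
    have addS: "?k (u + v) \<in> S" if "?k u \<in> S" "?k v \<in> S" for u v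
      using that S' by (simp add: k_add)
    have scaleS: "?k (km_scale sc c v) \<in> S" if "?k v \<in> S" for c v
      using that S' by (simp add: k_scale)
    \<comment> \<open>Expansion in the standard basis, with partial sums over finite
      \<open>A\<close> so that one basis vector is added at a time.\<close>
    have "?k (0, (\<Sum>i\<in>A. (u $ i) *s axis i 1), 0) \<in> S" if "finite A" for A and u :: "'k^'m"
      using that
    proof (induction A)
      case (insert i A)
      then show ?case
        using addS[OF scaleS[OF kE, of "u $ i" i] insert.IH] by (simp add: km_scale_def)
    qed (use kH[of 0] in simp)
    from this[of UNIV] have kU: "?k (0, u, 0) \<in> S" for u :: "'k^'m" by (simp add: basis_expansion)
    have "?k (0, 0, (\<Sum>i\<in>A. (u $ i) *s axis i 1)) \<in> S" if "finite A" for A and u :: "'k^'m"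
      using that
    proof (induction A)
      case (insert i A)
      then show ?case
        using addS[OF scaleS[OF kF, of "u $ i" i] insert.IH] by (simp add: km_scale_def)
    qed (use kH[of 0] in simp)
    from this[of UNIV] have kW: "?k (0, 0, u) \<in> S" for u :: "'k^'m" by (simp add: basis_expansion)
    have "?k (h, u, w) \<in> S" for h u w
      using addS[OF kH[of h] addS[OF kU[of u] kW[of w]]] by simp
    then have "range ?k \<subseteq> S" by auto
    then show "lie_carrier ?T \<subseteq> S" using gen_k S(1) unfolding lie_generated_by_def by blast
  qed
  show ?thesis
  proof (intro kac_moody_generators.intro T.lie_algebra_axioms kac_moody_generators_axioms.intro)
    show "?k (h + h', 0, 0) = lie_add ?T (?k (h, 0, 0)) (?k (h', 0, 0))" for h h'
      using k_add[of "(h, 0, 0)" "(h', 0, 0)"] by simp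
    show "?k (sc c h, 0, 0) = lie_scale ?T c (?k (h, 0, 0))" for c h
      using k_scale[of c "(h, 0, 0)"] by (simp add: km_scale_def)
  qed (rule k_closed EF HH HE HF generated)+
qed

section \<open>Linear algebra of a realization\<close>

lemma rows_eq_range: "rows M = range (\<lambda>i. row i M)"
  by (auto simp: rows_def)

text \<open>A dual family is built by adding one functional at a time. Independence yields a vector
  that the new functional sees and that, after correction, the old ones do not.\<close>

lemma dual_vectors_exist:
  fixes sc :: "'k::field \<Rightarrow> 'h::ab_group_add \<Rightarrow> 'h" and \<alpha> :: "'i \<Rightarrow> 'h \<Rightarrow> 'k"
  assumes lin: "\<And>i. Vector_Spaces.linear sc (*) (\<alpha> i)"
    and "finite I"
    and "\<And>c. (\<And>h. (\<Sum>i\<in>I. c i * \<alpha> i h) = 0) \<Longrightarrow> (\<forall>i\<in>I. c i = 0)"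
  shows "\<exists>u. \<forall>i\<in>I. \<forall>j\<in>I. \<alpha> i (u j) = (if i = j then 1 else 0)"
  using assms(2,3)
proof (induction I)
  case (insert k I)
  interpret k: Vector_Spaces.linear sc "(*)" "\<alpha> k" by (rule lin)
  have \<alpha>: "\<alpha> i (x - y) = \<alpha> i x - \<alpha> i y" "\<alpha> i (sc c x) = c * \<alpha> i x"
    "\<alpha> i (\<Sum>j\<in>J. f j) = (\<Sum>j\<in>J. \<alpha> i (f j))" for i x y c J and f :: "'i \<Rightarrow> 'h"
  proof -
    interpret l: Vector_Spaces.linear sc "(*)" "\<alpha> i" by (rule lin)
    show "\<alpha> i (x - y) = \<alpha> i x - \<alpha> i y" "\<alpha> i (sc c x) = c * \<alpha> i x"
      "\<alpha> i (\<Sum>j\<in>J. f j) = (\<Sum>j\<in>J. \<alpha> i (f j))"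
      by (rule l.diff l.scale l.sum)+
  qed
  have "\<forall>i\<in>I. c i = 0" if "\<And>h. (\<Sum>i\<in>I. c i * \<alpha> i h) = 0" for c
  proof -
    have "(\<Sum>i\<in>insert k I. (c(k := 0)) i * \<alpha> i h) = 0" for h
    proof -
      have "(\<Sum>i\<in>I. (c(k := 0)) i * \<alpha> i h) = (\<Sum>i\<in>I. c i * \<alpha> i h)"
        using insert.hyps by (intro sum.cong) auto
      then show ?thesis using that[of h] insert.hyps by simp
    qed
    from insert.prems[OF this] show ?thesis using insert.hyps(2) by (metis fun_upd_other insertI2)
  qed
  then have "\<exists>u. \<forall>i\<in>I. \<forall>j\<in>I. \<alpha> i (u j) = (if i = j then 1 else 0)" by (rule insert.IH)
  then obtain u where "\<forall>i\<in>I. \<forall>j\<in>I. \<alpha> i (u j) = (if i = j then 1 else 0)"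
    by (elim exE)
  then have u: "\<And>i j. i \<in> I \<Longrightarrow> j \<in> I \<Longrightarrow> \<alpha> i (u j) = (if i = j then 1 else 0)" by blast
  \<comment> \<open>Otherwise \<open>\<alpha> k\<close> would be a combination of the other
    functionals, a relation with coefficient 1 at \<open>k\<close>.\<close>
  have "\<exists>h. \<alpha> k h - (\<Sum>j\<in>I. \<alpha> k (u j) * \<alpha> j h) \<noteq> 0"
  proof (rule ccontr)
    assume "\<not> ?thesis"
    then have eq: "\<alpha> k h = (\<Sum>j\<in>I. \<alpha> k (u j) * \<alpha> j h)" for h
      by (metis eq_iff_diff_eq_0)
    have "(\<Sum>i\<in>insert k I. (if i = k then 1 else - \<alpha> k (u i)) * \<alpha> i h) = 0" for h
    proof -
      have "(\<Sum>i\<in>I. (if i = k then 1 else - \<alpha> k (u i)) * \<alpha> i h) = (\<Sum>i\<in>I. - (\<alpha> k (u i) * \<alpha> i h))"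
        using insert.hyps by (intro sum.cong) auto
      then show ?thesis using insert.hyps eq[of h] by (simp add: sum_negf)
    qed
    from insert.prems[OF this] show False by auto
  qed
  then obtain h where h: "\<alpha> k h - (\<Sum>j\<in>I. \<alpha> k (u j) * \<alpha> j h) \<noteq> 0" by blast
  define w where "w = h - (\<Sum>j\<in>I. sc (\<alpha> j h) (u j))"
  have wI: "\<alpha> i w = 0" if "i \<in> I" for i
  proof -
    have "(\<Sum>j\<in>I. \<alpha> j h * \<alpha> i (u j)) = (\<Sum>j\<in>I. if i = j then \<alpha> j h else 0)"
      using u[OF that] by (intro sum.cong) auto
    then show ?thesis using that insert.hyps by (simp add: w_def \<alpha>)
  qed
  have wk: "\<alpha> k w \<noteq> 0" using h by (simp add: w_def \<alpha> mult.commute)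
  define v where "v = sc (inverse (\<alpha> k w)) w"
  have v: "\<alpha> k v = 1" "\<And>i. i \<in> I \<Longrightarrow> \<alpha> i v = 0" using wk wI by (auto simp: v_def \<alpha>)
  show ?case
    \<comment> \<open>The normalized \<open>v\<close> becomes dual to \<open>k\<close>, and
      subtracting multiples of it makes \<open>\<alpha> k\<close> vanish on the old dual
      vectors.\<close>
    using v u insert.hyps
    by (intro exI[of _ "\<lambda>j. if j = k then v else u j - sc (\<alpha> k (u j)) v"]) (auto simp: \<alpha>)
qed simp

section \<open>Regular elements and spanning sets of the Cartan subalgebra\<close>

context
  fixes sc :: "'k::field_char_0 \<Rightarrow> 'h::ab_group_add \<Rightarrow> 'h"
    and A :: "'k^'m^'m" and \<alpha> :: "'m \<Rightarrow> 'h \<Rightarrow> 'k" and \<alpha>v :: "'m \<Rightarrow> 'h"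
  assumes realization: "realization sc A \<alpha> \<alpha>v"
begin

interpretation realization sc A \<alpha> \<alpha>v by (rule realization)

lemma root_simps:
  "\<alpha> i (x + y) = \<alpha> i x + \<alpha> i y" "\<alpha> i (sc c x) = c * \<alpha> i x"
  "\<alpha> i (\<Sum>j\<in>J. f j) = (\<Sum>j\<in>J. \<alpha> i (f j))"
proof -
  interpret l: Vector_Spaces.linear sc "(*)" "\<alpha> i" by (rule root_linear)
  show "\<alpha> i (x + y) = \<alpha> i x + \<alpha> i y" "\<alpha> i (sc c x) = c * \<alpha> i x"
    "\<alpha> i (\<Sum>j\<in>J. f j) = (\<Sum>j\<in>J. \<alpha> i (f j))"
    by (rule l.add l.scale l.sum)+
qed

lemma root_values_exist: "\<exists>h. \<forall>i. \<alpha> i h = b i"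
proof -
  obtain u where u: "\<And>i j. \<alpha> i (u j) = (if i = j then 1 else 0)"
    using dual_vectors_exist[of sc \<alpha> UNIV, OF root_linear finite] roots_independent by auto
  have "(\<Sum>j\<in>UNIV. b j * (if i = j then 1 else 0)) = b i" for i
    by (simp add: if_distrib cong: if_cong)
  then show ?thesis by (intro exI[of _ "\<Sum>j\<in>UNIV. sc (b j) (u j)"]) (simp add: root_simps u)
qed

lemma rank_le_card: "rank A \<le> CARD('m)"
proof -
  have "rank A \<le> card (rows A)"
    unfolding row_rank_def_gen by (rule vec.dim_le_card') (simp add: rows_eq_range)
  then show ?thesis using card_image_le[of UNIV "\<lambda>i. row i A"] by (simp add: rows_eq_range)
qed

text \<open>Take distinct positive integers as root values; in characteristic zero they are nonzero
  and no two add up to zero. \<open>Suc\<close> guards against the value 0.\<close>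

lemma regular_element:
  obtains h where "\<And>i. \<alpha> i h \<noteq> 0" "inj (\<lambda>i. \<alpha> i h)" "\<And>i j. \<alpha> i h \<noteq> - \<alpha> j h"
proof -
  obtain f :: "'m \<Rightarrow> nat" where f: "inj f"
    using finite_imp_inj_to_nat_seg[of "UNIV :: 'm set"] by auto
  obtain h where h: "\<And>i. \<alpha> i h = of_nat (Suc (f i))"
    using root_values_exist[of "\<lambda>i. of_nat (Suc (f i))"] by blast
  have "\<alpha> i h \<noteq> - \<alpha> j h" for i j
  proof
    assume "\<alpha> i h = - \<alpha> j h"
    then have "of_nat (Suc (f i)) + of_nat (Suc (f j)) = (0 :: 'k)"
      by (simp add: h eq_neg_iff_add_eq_0 del: of_nat_Suc)
    then have "of_nat (Suc (f i) + Suc (f j)) = (0 :: 'k)" by (simp only: of_nat_add)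
    then show False by (simp only: of_nat_eq_0_iff)
  qed
  moreover have "inj (\<lambda>i. \<alpha> i h)" using f by (auto simp: h inj_def simp del: of_nat_Suc)
  ultimately show thesis using h by (intro that[of h]) (auto simp del: of_nat_Suc)
qed

text \<open>The bound on the rank makes the prescribed dimension positive, and a set of positive
  cardinality is finite.\<close>

lemma card_extend_basis:
  assumes "independent S"
  shows "finite (extend_basis S)" "card (extend_basis S) = 2 * CARD('m) - rank A"
proof -
  show c: "card (extend_basis S) = 2 * CARD('m) - rank A"
    using dim_eq_card[OF _ independent_extend_basis[OF assms], of UNIV] dim_eq
      span_extend_basis[OF assms] by simp
  have "0 < 2 * CARD('m) - rank A" using rank_le_card zero_less_card_finite[where 'a = 'm] by linarith
  then show "finite (extend_basis S)" using c card_ge_0_finite by metis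
qed

lemma card_coroots: "card (range \<alpha>v) = CARD('m)"
  using card_image[OF coroots_distinct] by simp

lemma finite_affine_zeros: "a \<noteq> 0 \<Longrightarrow> finite {t. a + t * b = (0 :: 'k)}"
proof (rule finite_subset)
  assume a: "a \<noteq> 0"
  show "{t. a + t * b = 0} \<subseteq> {- a / b}"
  proof
    fix t assume t: "t \<in> {t. a + t * b = 0}"
    then have "b \<noteq> 0" using a by auto
    moreover have "t * b = - a" using t by (simp add: eq_neg_iff_add_eq_0 add.commute)
    ultimately show "t \<in> {- a / b}" by (simp add: field_simps)
  qed
qed simp

text \<open>Move a regular element \<open>g\<close> along a line whose direction \<open>w\<close> is
  not in the span of the coroots. Each unwanted condition excludes only finitely many parameters
  \<open>t\<close>, and the field is infinite.\<close>

lemma regular_element_off_coroots: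
  assumes "rank A < CARD('m)"
  obtains h where "h \<notin> span (range \<alpha>v)" "\<And>i. \<alpha> i h \<noteq> 0" "inj (\<lambda>i. \<alpha> i h)"
    "\<And>i j. \<alpha> i h \<noteq> - \<alpha> j h"
proof -
  obtain g where g: "\<And>i. \<alpha> i g \<noteq> 0" "inj (\<lambda>i. \<alpha> i g)" "\<And>i j. \<alpha> i g \<noteq> - \<alpha> j g"
    by (rule regular_element) (rule that)
  have "span (range \<alpha>v) \<noteq> UNIV"
  proof
    assume "span (range \<alpha>v) = UNIV"
    then have "dim UNIV = CARD('m)"
      using dim_eq_card[OF _ coroots_independent, of UNIV] card_coroots by simp
    then show False using dim_eq assms by linarith
  qed
  then obtain w where w: "w \<notin> span (range \<alpha>v)" by blast
  \<comment> \<open>The four bad sets: landing in the span of the coroots, which happens for at most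
    one \<open>t\<close> as two would put \<open>w\<close> there; a vanishing root value; two equal
    values; two opposite values.\<close>
  let ?B0 = "{t. g + sc t w \<in> span (range \<alpha>v)}"
  let ?B1 = "\<lambda>i. {t. \<alpha> i g + t * \<alpha> i w = 0}"
  let ?B2 = "\<lambda>(i, j). {t. (\<alpha> i g - \<alpha> j g) + t * (\<alpha> i w - \<alpha> j w) = 0}"
  let ?B3 = "\<lambda>(i, j). {t. (\<alpha> i g + \<alpha> j g) + t * (\<alpha> i w + \<alpha> j w) = 0}"
  have "finite ?B0"
  proof (cases "?B0 = {}")
    case False
    then obtain t where t: "g + sc t w \<in> span (range \<alpha>v)" by blast
    have "s = t" if "g + sc s w \<in> span (range \<alpha>v)" for s
    proof (rule ccontr)
      assume "s \<noteq> t"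
      have "sc (s - t) w \<in> span (range \<alpha>v)"
        using span_diff[OF that t] by (simp add: scale_left_diff_distrib)
      from span_scale[OF this, of "inverse (s - t)"] \<open>s \<noteq> t\<close> have "w \<in> span (range \<alpha>v)" by simp
      with w show False by blast
    qed
    then have "?B0 \<subseteq> {t}" by auto
    then show ?thesis by (rule finite_subset) simp
  qed simp
  moreover have "finite (\<Union>i. ?B1 i)" using g(1) by (auto intro: finite_affine_zeros)
  moreover have "finite (\<Union>p\<in>{(i, j). i \<noteq> j}. ?B2 p)"
  proof (intro finite_UN_I)
    fix p :: "'m \<times> 'm" assume "p \<in> {(i, j). i \<noteq> j}"
    then show "finite (?B2 p)" using g(2) by (auto simp: inj_eq intro!: finite_affine_zeros dest: injD)
  qed simp
  moreover have "finite (\<Union>p. ?B3 p)"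
  proof (intro finite_UN_I)
    fix p :: "'m \<times> 'm"
    show "finite (?B3 p)" using g(3) by (auto simp: eq_neg_iff_add_eq_0 intro!: finite_affine_zeros split: prod.split)
  qed simp
  ultimately have "finite (?B0 \<union> (\<Union>i. ?B1 i) \<union> (\<Union>p\<in>{(i, j). i \<noteq> j}. ?B2 p) \<union> (\<Union>p. ?B3 p))" by simp
  from ex_new_if_finite[OF infinite_UNIV_char_0 this]
  obtain t where t: "t \<notin> ?B0 \<union> (\<Union>i. ?B1 i) \<union> (\<Union>p\<in>{(i, j). i \<noteq> j}. ?B2 p) \<union> (\<Union>p. ?B3 p)"
    by (elim exE)
  show thesis
  proof (rule that[of "g + sc t w"])
    show "g + sc t w \<notin> span (range \<alpha>v)" using t by simp
    show "\<alpha> i (g + sc t w) \<noteq> 0" for i using t by (simp add: root_simps)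
    show "inj (\<lambda>i. \<alpha> i (g + sc t w))"
    proof (rule injI, rule ccontr)
      fix i j assume "\<alpha> i (g + sc t w) = \<alpha> j (g + sc t w)" "i \<noteq> j"
      then show False using t by (auto simp: root_simps algebra_simps)
    qed
    show "\<alpha> i (g + sc t w) \<noteq> - \<alpha> j (g + sc t w)" for i j
      using t by (auto simp: root_simps algebra_simps eq_neg_iff_add_eq_0)
  qed
qed

text \<open>At full rank the coroots already form a basis. Otherwise the regular element is chosen
  off their span, so that it counts as one of the \<open>m - r\<close> vectors completing them to a
  basis.\<close>

lemma regular_element_generating:
  assumes p: "CARD('m) - rank A \<le> p" "1 \<le> p"
  obtains u :: "nat \<Rightarrow> 'h" where "span (range \<alpha>v \<union> u ` {..<p}) = UNIV"
    "\<And>i. \<alpha> i (u 0) \<noteq> 0" "inj (\<lambda>i. \<alpha> i (u 0))" "\<And>i j. \<alpha> i (u 0) \<noteq> - \<alpha> j (u 0)"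
proof (cases "rank A < CARD('m)")
  case False
  obtain g where g: "\<And>i. \<alpha> i g \<noteq> 0" "inj (\<lambda>i. \<alpha> i g)" "\<And>i j. \<alpha> i g \<noteq> - \<alpha> j g"
    by (rule regular_element) (rule that)
  note ext = card_extend_basis[OF coroots_independent]
  have "range \<alpha>v = extend_basis (range \<alpha>v)"
    using ext card_coroots False rank_le_card
    by (intro card_subset_eq extend_basis_superset coroots_independent) auto
  then have "span (range \<alpha>v) = UNIV" using span_extend_basis[OF coroots_independent] by simp
  then have "span (range \<alpha>v \<union> (\<lambda>_. g) ` {..<p}) = UNIV"
    using span_mono[of "range \<alpha>v" "range \<alpha>v \<union> (\<lambda>_. g) ` {..<p}"] by auto
  then show thesis using g by (intro that[of "\<lambda>_. g"])
next
  case True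
  obtain g where g: "g \<notin> span (range \<alpha>v)" "\<And>i. \<alpha> i g \<noteq> 0" "inj (\<lambda>i. \<alpha> i g)"
    "\<And>i j. \<alpha> i g \<noteq> - \<alpha> j g"
    by (rule regular_element_off_coroots[OF True]) (rule that)
  have ind: "independent (insert g (range \<alpha>v))"
    using g(1) coroots_independent by (rule independent_insertI)
  let ?B = "extend_basis (insert g (range \<alpha>v))"
  note ext = card_extend_basis[OF ind] extend_basis_superset[OF ind]
  define C where "C = ?B - insert g (range \<alpha>v)"
  have "g \<notin> range \<alpha>v" using g(1) span_base by blast
  then have "card (insert g (range \<alpha>v)) = Suc (CARD('m))" using card_coroots by simp
  then have C: "finite C" "card C = CARD('m) - rank A - 1"
    unfolding C_def using ext by (simp_all add: card_Diff_subset)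
  obtain b where b: "bij_betw b {0..<card C} C" using ex_bij_betw_nat_finite[OF C(1)] by blast
  \<comment> \<open>The \<open>m - r - 1\<close> remaining basis vectors occupy the indices from 1
    on; together with \<open>g\<close> at index 0 they fit below \<open>p\<close>.\<close>
  define u where "u k = (if k = 0 then g else b (k - 1))" for k :: nat
  have "C \<subseteq> u ` {..<p}"
  proof
    fix x assume "x \<in> C"
    then obtain k where "k < card C" "x = b k" using bij_betw_imp_surj_on[OF b] by (metis imageE atLeastLessThan_iff)
    then have "x = u (Suc k)" "Suc k < p" using C(2) p by (auto simp: u_def)
    then show "x \<in> u ` {..<p}" by blast
  qed
  moreover have "g \<in> u ` {..<p}" using p(2) by (intro image_eqI[of _ _ 0]) (auto simp: u_def)
  ultimately have "?B \<subseteq> range \<alpha>v \<union> u ` {..<p}" unfolding C_def by blast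
  then have "span (range \<alpha>v \<union> u ` {..<p}) = UNIV"
    using span_mono[of ?B "range \<alpha>v \<union> u ` {..<p}"] span_extend_basis[OF ind]
    by (simp add: top.extremum_unique)
  moreover have "u 0 = g" by (simp add: u_def)
  ultimately show thesis using g by (intro that[of u]) auto
qed

end

section \<open>Ranks of integer matrices\<close>

text \<open>A linear relation over a field of characteristic zero is mapped to a rational one by a
  \<open>\<rat>\<close>-linear functional that does not vanish on a chosen nonzero coefficient.\<close>

lemma int_rows_independent_transfer:
  fixes B :: "int^'n^'m" and c :: "'m \<Rightarrow> 'k::field_char_0"
  assumes indep: "\<And>q :: 'm \<Rightarrow> real. (\<And>j. (\<Sum>i\<in>I. q i * of_int (B $ i $ j)) = 0) \<Longrightarrow> (\<forall>i\<in>I. q i = 0)"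
    and rel: "\<And>j. (\<Sum>i\<in>I. c i * of_int (B $ i $ j)) = 0"
    and i: "i \<in> I"
  shows "c i = 0"
proof (rule ccontr)
  assume nz: "c i \<noteq> 0"
  let ?s = "\<lambda>q x. of_rat q * (x :: 'k)"
  interpret V: vector_space ?s
    by unfold_locales (simp_all add: algebra_simps of_rat_add of_rat_mult)
  interpret Q: vector_space "(*) :: rat \<Rightarrow> rat \<Rightarrow> rat"
    by unfold_locales (simp_all add: algebra_simps)
  interpret P: vector_space_pair ?s "(*) :: rat \<Rightarrow> rat \<Rightarrow> rat" ..
  have "V.independent {c i}" using nz by simp
  \<comment> \<open>A nonzero coefficient is independent over the rationals, so the functional can
    be prescribed to be 1 there.\<close>
  then obtain g where g: "Vector_Spaces.linear ?s (*) g" "g (c i) = (1 :: rat)"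
    using P.linear_independent_extend[of "{c i}" "\<lambda>_. 1"] by auto
  interpret g: Vector_Spaces.linear ?s "(*)" g by (rule g(1))
  \<comment> \<open>The matrix entries are integers and pass through \<open>g\<close>, so the
    numbers \<open>g (c i)\<close>, read as reals, satisfy the same relation.\<close>
  have "(\<Sum>i\<in>I. real_of_rat (g (c i)) * of_int (B $ i $ j)) = 0" for j
  proof -
    have "g (c i * of_int (B $ i $ j)) = of_int (B $ i $ j) * g (c i)" for i
      using g.scale[of "of_int (B $ i $ j)" "c i"] by (simp add: mult.commute)
    then have "(\<Sum>i\<in>I. of_int (B $ i $ j) * g (c i)) = g (\<Sum>i\<in>I. c i * of_int (B $ i $ j))"
      by (simp add: g.sum)
    also have "\<dots> = 0" by (simp add: rel g.zero)
    finally have "real_of_rat (\<Sum>i\<in>I. of_int (B $ i $ j) * g (c i)) = 0" by simp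
    then show ?thesis by (simp add: of_rat_sum of_rat_mult mult.commute)
  qed
  from indep[OF this] i g(2) show False by auto
qed

text \<open>A basis of the real row space taken among the rows is indexed by \<open>I\<close>; the
  rows with these indices stay independent over the other field.\<close>

lemma rank_of_int_le:
  fixes B :: "int^'n^'m"
  shows "rank ((\<chi> i j. of_int (B $ i $ j)) :: real^'n^'m)
    \<le> rank ((\<chi> i j. of_int (B $ i $ j)) :: 'k::field_char_0^'n^'m)"
proof -
  let ?R = "(\<chi> i j. of_int (B $ i $ j)) :: real^'n^'m"
  let ?K = "(\<chi> i j. of_int (B $ i $ j)) :: 'k^'n^'m"
  obtain S where S: "S \<subseteq> rows ?R" "vec.independent S" "card S = rank ?R"
    using vec.basis_exists[of "rows ?R"] unfolding row_rank_def_gen by metis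
  have finS: "finite S" using S(1) by (rule finite_subset) (simp add: rows_eq_range)
  have "\<forall>s\<in>S. \<exists>i. s = row i ?R" using S(1) unfolding rows_def by blast
  then obtain f where f: "\<And>s. s \<in> S \<Longrightarrow> s = row (f s) ?R" by metis
  define I where "I = f ` S"
  have inj_f: "inj_on f S" using f by (metis inj_onI)
  have rowI: "row i ?R \<in> S" "f (row i ?R) = i" if "i \<in> I" for i
    using that f unfolding I_def by (metis imageE)+
  have rows_nth: "row i ?R $ j = of_int (B $ i $ j)" "row i ?K $ j = of_int (B $ i $ j)" for i j
    by (simp_all add: row_def)
  have indep: "\<forall>i\<in>I. q i = 0" if q: "\<And>j. (\<Sum>i\<in>I. q i * of_int (B $ i $ j)) = (0 :: real)" for q
  proof -
    have "(\<Sum>s\<in>S. q (f s) *s s) $ j = 0" for j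
    proof -
      have "(\<Sum>s\<in>S. q (f s) *s s) $ j = (\<Sum>s\<in>S. q (f s) * of_int (B $ f s $ j))"
        using f rows_nth(1) by (simp add: sum_component) (metis (mono_tags, lifting) sum.cong)
      also have "\<dots> = 0" using q[of j] unfolding I_def by (simp add: sum.reindex[OF inj_f])
      finally show ?thesis .
    qed
    then have "(\<Sum>s\<in>S. q (f s) *s s) = 0" by (simp add: vec_eq_iff)
    moreover have "\<not> ((\<exists>s\<in>S. q (f s) \<noteq> 0) \<and> (\<Sum>s\<in>S. q (f s) *s s) = 0)"
      using S(2) unfolding vec.dependent_finite[OF finS]
      by (rule contrapos_nn) (rule exI[of _ "\<lambda>s. q (f s)"])
    ultimately have "\<forall>s\<in>S. q (f s) = 0" by simp
    then show ?thesis unfolding I_def by blast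
  qed
  \<comment> \<open>Integers embed into both fields, so rows that agree over one agree over the
    other.\<close>
  have inj_K: "inj_on (\<lambda>i. row i ?K) I"
  proof (rule inj_onI)
    fix i j assume ij: "i \<in> I" "j \<in> I" "row i ?K = row j ?K"
    then have "B $ i $ k = B $ j $ k" for k by (metis rows_nth(2) of_int_eq_iff)
    then have "row i ?R = row j ?R" by (simp add: row_def)
    then have "f (row i ?R) = f (row j ?R)" by (rule arg_cong)
    then show "i = j" unfolding rowI(2)[OF ij(1)] rowI(2)[OF ij(2)] .
  qed
  have "vec.independent ((\<lambda>i. row i ?K) ` I)"
  proof (rule vec.independent_if_scalars_zero)
    show "finite ((\<lambda>i. row i ?K) ` I)" using finS by (simp add: I_def)
    fix c x assume c: "(\<Sum>x\<in>(\<lambda>i. row i ?K) ` I. c x *s x) = 0" and x: "x \<in> (\<lambda>i. row i ?K) ` I"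
    obtain i where i: "i \<in> I" "x = row i ?K" using x by blast
    have "(\<Sum>i\<in>I. c (row i ?K) * of_int (B $ i $ j)) = 0" for j
    proof -
      have "(\<Sum>i\<in>I. c (row i ?K) *s row i ?K) $ j = 0" using c by (simp add: sum.reindex[OF inj_K])
      then show ?thesis by (simp add: sum_component rows_nth(2))
    qed
    from int_rows_independent_transfer[OF indep this i(1)] show "c x = 0" using i(2) by simp
  qed
  then have "card ((\<lambda>i. row i ?K) ` I) \<le> rank ?K"
    unfolding row_rank_def_gen by (intro vec.independent_card_le_dim) (auto simp: rows_def)
  moreover have "card ((\<lambda>i. row i ?K) ` I) = rank ?R"
    using card_image[OF inj_K] card_image[OF inj_f] S(3) by (simp add: I_def)
  ultimately show ?thesis by simp
qed

text \<open>Affine type fixes the rank over the reals, whereas \<open>A\<close> has entries in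
  another field; the comparison of ranks bridges the two.\<close>

lemma rank_affine_cartan_matrix:
  fixes A :: "'k::field_char_0^'m^'m"
  assumes "affine_cartan_matrix A" shows "CARD('m) \<le> rank A + 1"
proof -
  obtain B :: "int^'m^'m" where B: "A = (\<chi> i j. of_int (B $ i $ j))"
    "affine_type (\<chi> i j. of_int (B $ i $ j))"
    using assms unfolding affine_cartan_matrix_def by blast
  then show ?thesis using rank_of_int_le[of B, where 'k = 'k] by (simp add: affine_type_def)
qed

section \<open>Assembly of the quotient maps\<close>

lemma quotients_of_yang_mills:
  fixes A :: "'k::{alg_closed_field, field_char_0}^'m^'m"
    and sc :: "'k \<Rightarrow> 'h::ab_group_add \<Rightarrow> 'h"
  assumes n: "4 \<le> n" "2 * (CARD('m) - rank A) \<le> n" and realization: "realization sc A \<alpha> \<alpha>v"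
  shows "is_lie_quotient_of (km_tilde sc \<alpha> \<alpha>v) (yang_mills n)"
    and "is_lie_quotient_of (kac_moody sc \<alpha> \<alpha>v) (yang_mills n)"
proof -
  have vs: "vector_space sc" using realization by (simp add: realization_def)
  interpret kac_moody_generators "km_tilde sc \<alpha> \<alpha>v" sc "\<lambda>h. km_incl sc \<alpha> \<alpha>v (h, 0, 0)"
    "\<lambda>i. km_incl sc \<alpha> \<alpha>v (0, axis i 1, 0)" "\<lambda>i. km_incl sc \<alpha> \<alpha>v (0, 0, axis i 1)" \<alpha> \<alpha>v
    by (rule kac_moody_generators_km_tilde[OF vs])
  \<comment> \<open>The number of generators to aim for is \<open>n div 2\<close>, since each of
    them uses up two generators of the Yang-Mills algebra.\<close>
  have p: "CARD('m) - rank A \<le> n div 2" "2 \<le> n div 2" using n by linarith+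
  obtain u where u: "module.span sc (range \<alpha>v \<union> u ` {..<n div 2}) = UNIV"
    "\<And>i. \<alpha> i (u 0) \<noteq> 0" "inj (\<lambda>i. \<alpha> i (u 0))" "\<And>i j. \<alpha> i (u 0) \<noteq> - \<alpha> j (u 0)"
    by (rule regular_element_generating[OF realization p(1)]) (use p(2) in simp, rule that)
  obtain y where y: "lie_generated_by (km_tilde sc \<alpha> \<alpha>v) (y ` {..<n div 2})"
    by (rule generated_by_few[OF vs p(2) u])
  \<comment> \<open>Algebraic closedness supplies the square root of \<open>-1\<close> for the
    pairwise cancellation.\<close>
  obtain \<omega> :: 'k where "\<omega> ^ 2 = -1" using nth_root_exists[of 2 "-1 :: 'k"] by auto
  then have \<omega>: "\<omega> * \<omega> = -1" by (simp add: power2_eq_square)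
  show tilde: "is_lie_quotient_of (km_tilde sc \<alpha> \<alpha>v) (yang_mills n)"
    by (rule is_lie_quotient_of_yang_mills[OF lie_algebra_axioms y _ \<omega>]) simp
  obtain h0 where h0: "\<And>i. \<alpha> i h0 = 1"
    using root_values_exist[OF realization, of "\<lambda>_. 1"] by blast
  have "km_cartan sc \<alpha> \<alpha>v = range (\<lambda>h. km_incl sc \<alpha> \<alpha>v (h, 0, 0))"
    by (simp add: km_cartan_def km_incl_def)
  then have "lie_ideal (km_tilde sc \<alpha> \<alpha>v) (km_radical sc \<alpha> \<alpha>v)"
    using lie_ideal_maximal_trivially_intersecting[OF h0] by (simp add: km_radical_def Let_def)
  then have "is_lie_quotient_of (kac_moody sc \<alpha> \<alpha>v) (km_tilde sc \<alpha> \<alpha>v)"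
    unfolding kac_moody_def by (rule is_lie_quotient_of_lie_quotient)
  then show "is_lie_quotient_of (kac_moody sc \<alpha> \<alpha>v) (yang_mills n)"
    using tilde by (rule is_lie_quotient_of_trans)
qed

theorem corollary2p4:
  fixes A :: "'k::{alg_closed_field, field_char_0}^'m^'m"
    and sc :: "'k \<Rightarrow> 'h::ab_group_add \<Rightarrow> 'h"
    and \<alpha> :: "'m \<Rightarrow> 'h \<Rightarrow> 'k"
    and \<alpha>v :: "'m \<Rightarrow> 'h"
    and n :: nat
  assumes "n \<ge> 4"
    and "realization sc A \<alpha> \<alpha>v"
  shows "(rank A + 2 \<ge> CARD('m) \<longrightarrow>
            is_lie_quotient_of (kac_moody sc \<alpha> \<alpha>v) (yang_mills n) \<and>
            is_lie_quotient_of (km_tilde sc \<alpha> \<alpha>v) (yang_mills n)) \<and>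
         (affine_cartan_matrix A \<longrightarrow>
            is_lie_quotient_of (kac_moody sc \<alpha> \<alpha>v) (yang_mills n)) \<and>
         (rank A + 2 \<le> CARD('m) \<longrightarrow> n \<ge> 2 * (CARD('m) - rank A) \<longrightarrow>
            is_lie_quotient_of (kac_moody sc \<alpha> \<alpha>v) (yang_mills n) \<and>
            is_lie_quotient_of (km_tilde sc \<alpha> \<alpha>v) (yang_mills n))"
proof -
  have quotients: "is_lie_quotient_of (kac_moody sc \<alpha> \<alpha>v) (yang_mills n) \<and>
      is_lie_quotient_of (km_tilde sc \<alpha> \<alpha>v) (yang_mills n)"
    if "2 * (CARD('m) - rank A) \<le> n"
    using quotients_of_yang_mills[OF assms(1) that assms(2)] by blast
  \<comment> \<open>Here the corank is at most 2, so \<open>n \<ge> 4\<close> is enough; affine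
    matrices have corank at most 1 and fall under this case.\<close>
  have "2 * (CARD('m) - rank A) \<le> n" if "rank A + 2 \<ge> CARD('m)"
    using that assms(1) by linarith
  moreover have "rank A + 2 \<ge> CARD('m)" if "affine_cartan_matrix A"
    using rank_affine_cartan_matrix[OF that] by linarith
  ultimately show ?thesis using quotients by blast
qed

end
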